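(* There exist absolute constants $c_1,c_2>0$ such that the following holds. Let $\alpha,\beta,k>0$, and set \[\gamma=\frac{4\alpha k+\beta+\sqrt{(4\alpha k+\beta)\beta}}{2k(4\alpha k+\beta)},\qquad \sigma=\sigma(\alpha,\beta,k)=\alpha\gamma+\frac{\beta\gamma^{2}}{4k\gamma-2}.\] For every grid $G$ of area $A$ and perimeter $P$ there exists a covering path $P_G$ of $G$ with coverage radius $k$ such that \[\mathrm{Cost}(P_G)=\alpha L+\beta T\leq 2\sigma\,(A+c_1kP+c_2k^{2}),\] where $L$ and $T$ are the path length and stop count of $P_G$.
   Context: A unit square in $\mathbb{R}^2$ is integral if its corners have integer coordinates; a grid is a union of integral unit squares; $A$ is its area and $P$ the length of its boundary. Distances are measured in the $\ell_1$ norm. Given a grid $G$ and coverage radius $k>0$, a covering path of $G$ is a finite sequence of points (stops) $S_1,\dots,S_T\in G$ such that every point of $G$ is at $\ell_1$-distance at most $k$ from some $S_i$. Its stop count is $T$ and its path length is $L=\sum_{i=1}^{T-1}\|S_{i+1}-S_i\|_1$; for $\alpha,\beta>0$ its cost is $\alpha L+\beta T$.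
   Formalization: The grid is assumed to be a connected union of finitely many unit squares (corner contacts and holes allowed); without connectedness the claim fails, e.g. for two unit squares far apart, where A and P stay fixed but every covering path is long. *)

theory Defs
  imports "HOL-Analysis.Analysis"
begin

definition l1_dist :: "real \<times> real \<Rightarrow> real \<times> real \<Rightarrow> real" where
  "l1_dist p q = \<bar>fst p - fst q\<bar> + \<bar>snd p - snd q\<bar>"

definition unit_square :: "int \<times> int \<Rightarrow> (real \<times> real) set" where
  "unit_square c =
     {of_int (fst c)..of_int (fst c) + 1} \<times> {of_int (snd c)..of_int (snd c) + 1}"

text \<open>Grids are finite unions, so that area and perimeter are finite. Connectedness is not
  part of this predicate; it is needed as a separate hypothesis when bounding the cost of covering
  paths, since for two unit squares at large distance any covering path is long while area and
  perimeter stay fixed.\<close>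

definition is_grid :: "(real \<times> real) set \<Rightarrow> bool" where
  "is_grid G \<longleftrightarrow> (\<exists>Q. finite Q \<and> G = (\<Union>c\<in>Q. unit_square c))"

definition grid_area :: "(real \<times> real) set \<Rightarrow> real" where
  "grid_area G = measure lebesgue G"

definition hor_edge :: "int \<Rightarrow> int \<Rightarrow> (real \<times> real) set" where
  "hor_edge i j = {of_int i..of_int i + 1} \<times> {of_int j}"

definition ver_edge :: "int \<Rightarrow> int \<Rightarrow> (real \<times> real) set" where
  "ver_edge i j = {of_int i} \<times> {of_int j..of_int j + 1}"

definition boundary_edges :: "(real \<times> real) set \<Rightarrow> (real \<times> real) set set" where
  "boundary_edges G =
     {e. (\<exists>i j. e = hor_edge i j \<or> e = ver_edge i j) \<and> e \<subseteq> frontier G}"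

text \<open>The topological boundary of a grid is the union of finitely many integral unit segments
  (lemmas \<open>frontier_grid\<close> and \<open>finite_boundary_edges\<close> below), any two of which share at most an
  endpoint. Its length is therefore the number of these segments; boundaries of holes count.\<close>

definition perimeter :: "(real \<times> real) set \<Rightarrow> real" where
  "perimeter G = real (card (boundary_edges G))"

definition covering_path :: "(real \<times> real) set \<Rightarrow> real \<Rightarrow> (real \<times> real) list \<Rightarrow> bool" where
  "covering_path G k S \<longleftrightarrow>
     set S \<subseteq> G \<and> (\<forall>p\<in>G. \<exists>s\<in>set S. l1_dist p s \<le> k)"

definition stop_count :: "(real \<times> real) list \<Rightarrow> nat" where
  "stop_count S = length S"

definition path_length :: "(real \<times> real) list \<Rightarrow> real" where
  "path_length S = (\<Sum>i<length S - 1. l1_dist (S ! Suc i) (S ! i))"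

definition path_cost :: "real \<Rightarrow> real \<Rightarrow> (real \<times> real) list \<Rightarrow> real" where
  "path_cost \<alpha> \<beta> S = \<alpha> * path_length S + \<beta> * real (stop_count S)"

definition gamma_param :: "real \<Rightarrow> real \<Rightarrow> real \<Rightarrow> real" where
  "gamma_param \<alpha> \<beta> k =
     (4 * \<alpha> * k + \<beta> + sqrt ((4 * \<alpha> * k + \<beta>) * \<beta>)) / (2 * k * (4 * \<alpha> * k + \<beta>))"

definition sigma_param :: "real \<Rightarrow> real \<Rightarrow> real \<Rightarrow> real" where
  "sigma_param \<alpha> \<beta> k =
     \<alpha> * gamma_param \<alpha> \<beta> k
     + \<beta> * (gamma_param \<alpha> \<beta> k)\<^sup>2 / (4 * k * gamma_param \<alpha> \<beta> k - 2)"

lemma closed_unit_square: "closed (unit_square c)"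
  unfolding unit_square_def by (intro closed_Times closed_atLeastAtMost)

lemma closed_grid: "is_grid G \<Longrightarrow> closed G"
  unfolding is_grid_def using closed_unit_square by auto

lemma square_disjoint_interior:
  assumes "G = (\<Union>c\<in>Q. unit_square c)" "d \<notin> Q"
  shows "unit_square d \<inter> interior G = {}"
proof -
  obtain i j where d: "d = (i, j)" by (cases d)
  define B where "B = {real_of_int i<..<of_int i + 1} \<times> {real_of_int j<..<of_int j + 1}"
  have "B \<inter> G = {}"
  proof (rule ccontr)
    assume "B \<inter> G \<noteq> {}"
    then obtain u v a b where
      "real_of_int i < u" "u < of_int i + 1" "real_of_int j < v" "v < of_int j + 1"
      and ab: "(a, b) \<in> Q" "real_of_int a \<le> u" "u \<le> of_int a + 1" "real_of_int b \<le> v" "v \<le> of_int b + 1"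
      unfolding B_def assms(1) unit_square_def by auto
    hence "real_of_int a < of_int (i + 1)" "real_of_int i < of_int (a + 1)"
      "real_of_int b < of_int (j + 1)" "real_of_int j < of_int (b + 1)" by simp_all
    hence "a = i" "b = j" unfolding of_int_less_iff by simp_all
    thus False using ab assms d by simp
  qed
  hence "interior G \<inter> B = {}" using interior_subset by blast
  hence "interior G \<inter> closure B = {}" by (simp add: open_Int_closure_eq_empty)
  moreover have "closure B = unit_square d"
    unfolding B_def d unit_square_def by (simp add: closure_Times)
  ultimately show ?thesis by blast
qed

lemma squares_Int_subset_frontier:
  assumes "G = (\<Union>c\<in>Q. unit_square c)" "c \<in> Q" "d \<notin> Q"
    "e \<subseteq> unit_square c" "e \<subseteq> unit_square d"
  shows "e \<subseteq> frontier G"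
proof -
  have "e \<subseteq> closure G" using assms closure_subset by blast
  thus ?thesis using square_disjoint_interior[OF assms(1,3)] assms(5)
    unfolding frontier_def by blast
qed

lemma in_interior_grid:
  assumes "G = (\<Union>c\<in>Q. unit_square c)" "\<And>c. p \<in> unit_square c \<Longrightarrow> c \<in> Q"
  shows "p \<in> interior G"
proof -
  obtain x y where p: "p = (x, y)" by (cases p)
  define U where "U = {real_of_int (\<lceil>x\<rceil> - 1)<..<of_int (\<lfloor>x\<rfloor> + 1)}
    \<times> {real_of_int (\<lceil>y\<rceil> - 1)<..<of_int (\<lfloor>y\<rfloor> + 1)}"
  have loc: "real_of_int \<lfloor>t\<rfloor> \<le> s" "s \<le> of_int \<lfloor>t\<rfloor> + 1"
    if "real_of_int (\<lceil>s\<rceil> - 1) < t" "t < of_int (\<lfloor>s\<rfloor> + 1)" for s t :: real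
  proof -
    have "\<lceil>s\<rceil> - 1 \<le> \<lfloor>t\<rfloor>" using that(1) by (simp add: le_floor_iff)
    hence "real_of_int \<lceil>s\<rceil> \<le> of_int (\<lfloor>t\<rfloor> + 1)" unfolding of_int_le_iff by simp
    thus "s \<le> of_int \<lfloor>t\<rfloor> + 1" using le_of_int_ceiling[of s] unfolding of_int_add of_int_1 by linarith
    have "\<lfloor>t\<rfloor> < \<lfloor>s\<rfloor> + 1" using that(2) by (simp only: floor_less_iff)
    hence "real_of_int \<lfloor>t\<rfloor> \<le> of_int \<lfloor>s\<rfloor>" unfolding of_int_le_iff by simp
    thus "real_of_int \<lfloor>t\<rfloor> \<le> s" using of_int_floor_le[of s] by linarith
  qed
  have "open U" unfolding U_def by (intro open_Times open_greaterThanLessThan)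
  moreover have "p \<in> U" unfolding U_def p
    using ceiling_correct[of x] floor_correct[of x] ceiling_correct[of y] floor_correct[of y] by simp
  moreover have "U \<subseteq> G"
  proof
    fix w assume "w \<in> U"
    then obtain u v where w: "w = (u, v)" and
      "real_of_int (\<lceil>x\<rceil> - 1) < u" "u < of_int (\<lfloor>x\<rfloor> + 1)"
      "real_of_int (\<lceil>y\<rceil> - 1) < v" "v < of_int (\<lfloor>y\<rfloor> + 1)"
      unfolding U_def by auto
    hence "p \<in> unit_square (\<lfloor>u\<rfloor>, \<lfloor>v\<rfloor>)"
      using loc[of x u] loc[of y v] unfolding p unit_square_def by simp
    moreover have "w \<in> unit_square (\<lfloor>u\<rfloor>, \<lfloor>v\<rfloor>)"
      unfolding w unit_square_def by (simp add: less_imp_le)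
    ultimately show "w \<in> G" using assms by blast
  qed
  ultimately show ?thesis by (rule interiorI)
qed

lemma adjacent_boundary_edge:
  assumes G: "G = (\<Union>c\<in>Q. unit_square c)" and "c \<in> Q" "d \<notin> Q"
    and p: "p \<in> unit_square c" "p \<in> unit_square d"
    and adj: "fst c = fst d \<or> snd c = snd d"
  shows "p \<in> \<Union>(boundary_edges G)"
proof -
  obtain i j i' j' x y where eq: "c = (i, j)" "d = (i', j')" "p = (x, y)"
    by (cases c, cases d, cases p)
  have b: "real_of_int i \<le> x" "x \<le> of_int i + 1" "real_of_int i' \<le> x" "x \<le> of_int i' + 1"
    "real_of_int j \<le> y" "y \<le> of_int j + 1" "real_of_int j' \<le> y" "y \<le> of_int j' + 1"
    using p unfolding eq unit_square_def by auto
  have "real_of_int i \<le> of_int (i' + 1)" "real_of_int i' \<le> of_int (i + 1)"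
    "real_of_int j \<le> of_int (j' + 1)" "real_of_int j' \<le> of_int (j + 1)"
    using b by simp_all
  hence ii: "i \<le> i' + 1" "i' \<le> i + 1" "j \<le> j' + 1" "j' \<le> j + 1"
    unfolding of_int_le_iff by simp_all
  have "c \<noteq> d" using assms by blast
  have "\<exists>e. (\<exists>i j. e = hor_edge i j \<or> e = ver_edge i j) \<and> p \<in> e
      \<and> e \<subseteq> unit_square c \<and> e \<subseteq> unit_square d"
  proof (cases "i = i'")
    case True
    with \<open>c \<noteq> d\<close> have "j' = j + 1 \<or> j = j' + 1" using ii eq by auto
    hence "p \<in> hor_edge i (max j j') \<and> hor_edge i (max j j') \<subseteq> unit_square c
        \<and> hor_edge i (max j j') \<subseteq> unit_square d"
      using True b unfolding eq hor_edge_def unit_square_def by auto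
    thus ?thesis by blast
  next
    case False
    hence "j = j'" using adj eq by simp
    have "i' = i + 1 \<or> i = i' + 1" using False ii by auto
    hence "p \<in> ver_edge (max i i') j \<and> ver_edge (max i i') j \<subseteq> unit_square c
        \<and> ver_edge (max i i') j \<subseteq> unit_square d"
      using \<open>j = j'\<close> b unfolding eq ver_edge_def unit_square_def by auto
    thus ?thesis by blast
  qed
  thus ?thesis
    using squares_Int_subset_frontier[OF G \<open>c \<in> Q\<close> \<open>d \<notin> Q\<close>] unfolding boundary_edges_def by blast
qed

lemma frontier_grid:
  assumes "is_grid G"
  shows "frontier G = \<Union>(boundary_edges G)"
proof
  show "\<Union>(boundary_edges G) \<subseteq> frontier G" unfolding boundary_edges_def by blast
  show "frontier G \<subseteq> \<Union>(boundary_edges G)"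
  proof
    fix p assume fr: "p \<in> frontier G"
    obtain Q where G: "G = (\<Union>c\<in>Q. unit_square c)" using assms unfolding is_grid_def by blast
    have "p \<in> G" "p \<notin> interior G"
      using fr closed_grid[OF assms] unfolding frontier_def by auto
    then obtain c d where c: "c \<in> Q" "p \<in> unit_square c" and d: "d \<notin> Q" "p \<in> unit_square d"
      using in_interior_grid[OF G] G by blast
    define m where "m = (fst d, snd c)"
    have m: "p \<in> unit_square m" using c d unfolding m_def unit_square_def by auto
    show "p \<in> \<Union>(boundary_edges G)"
    proof (cases "m \<in> Q")
      case True
      show ?thesis by (rule adjacent_boundary_edge[OF G True d(1) m d(2)]) (simp add: m_def)
    next
      case False
      show ?thesis by (rule adjacent_boundary_edge[OF G c(1) False c(2) m]) (simp add: m_def)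
    qed
  qed
qed

lemma finite_boundary_edges:
  assumes "is_grid G"
  shows "finite (boundary_edges G)"
proof -
  obtain Q where fin: "finite Q" and G: "G = (\<Union>c\<in>Q. unit_square c)"
    using assms unfolding is_grid_def by blast
  have mid: "a = i" if "real_of_int a \<le> of_int i + 1/2" "real_of_int i + 1/2 \<le> of_int a + 1" for a i
  proof -
    have "real_of_int a < of_int (i + 1)" "real_of_int i < of_int (a + 1)"
      using that by simp_all
    thus ?thesis unfolding of_int_less_iff by simp
  qed
  have near: "i = a \<or> i = a + 1" if "real_of_int a \<le> of_int i" "real_of_int i \<le> of_int a + 1" for a i
  proof -
    have "real_of_int a \<le> of_int i" "real_of_int i \<le> of_int (a + 1)" using that by simp_all
    thus ?thesis unfolding of_int_le_iff by auto
  qed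
  define F where "F = (\<Union>(a, b)\<in>Q. {hor_edge a b, hor_edge a (b + 1), ver_edge a b, ver_edge (a + 1) b})"
  have "e \<in> F" if e_in: "e \<in> boundary_edges G" for e
  proof -
    have sub: "e \<subseteq> G" using e_in closed_grid[OF assms] frontier_subset_closed
      unfolding boundary_edges_def by blast
    obtain i j where "e = hor_edge i j \<or> e = ver_edge i j"
      using e_in unfolding boundary_edges_def by blast
    thus ?thesis
    proof
      assume e: "e = hor_edge i j"
      hence "(of_int i + 1/2, of_int j) \<in> G" using sub unfolding hor_edge_def by auto
      then obtain a b where ab: "(a, b) \<in> Q"
        "real_of_int a \<le> of_int i + 1/2" "real_of_int i + 1/2 \<le> of_int a + 1"
        "real_of_int b \<le> of_int j" "real_of_int j \<le> of_int b + 1"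
        unfolding G unit_square_def by auto
      show ?thesis unfolding F_def e
        using ab(1) mid[OF ab(2,3)] near[OF ab(4,5)] by auto
    next
      assume e: "e = ver_edge i j"
      hence "(of_int i, of_int j + 1/2) \<in> G" using sub unfolding ver_edge_def by auto
      then obtain a b where ab: "(a, b) \<in> Q"
        "real_of_int b \<le> of_int j + 1/2" "real_of_int j + 1/2 \<le> of_int b + 1"
        "real_of_int a \<le> of_int i" "real_of_int i \<le> of_int a + 1"
        unfolding G unit_square_def by auto
      show ?thesis unfolding F_def e
        using ab(1) mid[OF ab(2,3)] near[OF ab(4,5)] by auto
    qed
  qed
  moreover have "finite F" unfolding F_def using fin by auto
  ultimately show ?thesis by (meson finite_subset subsetI)
qed

end

theory Submission
  imports Defs
begin

text \<open>Since \<open>2\<sigma> \<ge> \<alpha> / k + \<beta> / k\<^sup>2\<close>, it suffices to cover \<open>G\<close> with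
  \<open>L \<le> A / k + O(P + k)\<close> and \<open>T \<le> A / k\<^sup>2 + O(P / k + 1)\<close>. A staggered lattice of stops with
  row distance \<open>3k / 2\<close> and stop distance \<open>k\<close> needs only two thirds of both leading terms, and the
  difference pays for moving each stop to a nearby point of \<open>G\<close> and for rounding \<open>k\<close> to a multiple
  of a subdivided cell.

  Group the lattice into square blocks containing two rows of stops each. By a discrete
  isoperimetric argument, a block near which the boundary is short is almost full, unless \<open>G\<close> is
  contained in a neighbourhood of that block. The other blocks near \<open>G\<close> are called rich; there are
  \<open>O(P / k)\<close> of them, and each may receive a bounded number of extra stops. The right neighbour of an
  almost full block is again almost full or rich, so every horizontal run of almost full blocks ends
  at a rich block. Such a run is traversed as a loop, along its lower row of stops and back along the
  upper one. Loops, unlike paths, can be merged at arbitrary points without traversing anything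
  twice, so the connectedness of \<open>G\<close> joins them all at an extra length of \<open>O(k)\<close> per rich block.\<close>

section \<open>Merging closed tours\<close>

text \<open>The codomain is polymorphic because the same notion measures integer tours through tiles
  and real paths through stops.\<close>

fun walk_length :: "('a \<Rightarrow> 'a \<Rightarrow> 'b::linordered_idom) \<Rightarrow> 'a list \<Rightarrow> 'b" where
  "walk_length d (x # y # xs) = d x y + walk_length d (y # xs)"
| "walk_length d xs = 0"

text \<open>For \<open>[]\<close> the walk consists of the single default entry \<open>hd []\<close>
  and has length 0.\<close>

definition closed_length :: "('a \<Rightarrow> 'a \<Rightarrow> 'b::linordered_idom) \<Rightarrow> 'a list \<Rightarrow> 'b" where
  "closed_length d xs = walk_length d (xs @ [hd xs])"

lemma walk_length_split:
  "walk_length d (us @ a # vs) = walk_length d (us @ [a]) + walk_length d (a # vs)"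
proof (induction us)
  case (Cons u us)
  then show ?case by (cases us) auto
qed simp

lemma walk_length_append:
  assumes "xs \<noteq> []" "ys \<noteq> []"
  shows "walk_length d (xs @ ys) = walk_length d xs + d (last xs) (hd ys) + walk_length d ys"
proof -
  obtain us a where xs: "xs = us @ [a]" using assms(1) by (cases xs rule: rev_cases) auto
  obtain b vs where ys: "ys = b # vs" using assms(2) by (cases ys) auto
  show ?thesis using walk_length_split[of d us a "b # vs"] unfolding xs ys by simp
qed

lemma walk_length_bound:
  assumes "\<And>x y. x \<in> set xs \<Longrightarrow> y \<in> set xs \<Longrightarrow> d x y \<le> c" "c \<ge> 0"
  shows "walk_length d xs \<le> of_nat (length xs) * c"
  using assms
proof (induction d xs rule: walk_length.induct)
  case (1 d x y xs)
  have "walk_length d (y # xs) \<le> of_nat (length (y # xs)) * c" using 1 by simp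
  moreover have "d x y \<le> c" using 1(2) by simp
  ultimately show ?case by (simp add: algebra_simps)
qed auto

locale semimetric =
  fixes d :: "'a \<Rightarrow> 'a \<Rightarrow> 'b::linordered_idom"
  assumes nonneg: "0 \<le> d x y"
    and commute: "d x y = d y x"
    and triangle: "d x z \<le> d x y + d y z"
begin

lemma walk_length_delete: "walk_length d (xs @ zs) \<le> walk_length d (xs @ b # zs)"
proof (cases "xs = [] \<or> zs = []")
  case True
  then show ?thesis
  proof
    assume "xs = []"
    then show ?thesis by (cases zs) (auto simp: nonneg)
  next
    assume "zs = []"
    then show ?thesis
      by (cases "xs = []") (simp_all add: walk_length_append nonneg)
  qed
next
  case False
  have "walk_length d (b # zs) = d b (hd zs) + walk_length d zs" using False by (cases zs) auto
  then show ?thesis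
    using False triangle[of "last xs" "hd zs" b] by (simp add: walk_length_append)
qed

lemma walk_le_closed: "walk_length d xs \<le> closed_length d xs"
  unfolding closed_length_def using walk_length_delete[of xs "[]" "hd xs"] by simp

lemma closed_length_rotate: "closed_length d (ys @ b # zs) = walk_length d (b # zs @ ys @ [b])"
proof (cases ys)
  case (Cons c cs)
  have "walk_length d (c # cs @ b # zs @ [c]) = walk_length d (c # cs @ [b]) + walk_length d (b # zs @ [c])"
    using walk_length_split[of d "c # cs" b "zs @ [c]"] by simp
  moreover have "walk_length d (b # zs @ c # cs @ [b]) = walk_length d (b # zs @ [c]) + walk_length d (c # cs @ [b])"
    using walk_length_split[of d "b # zs" c "cs @ [b]"] by simp
  ultimately show ?thesis by (simp add: closed_length_def Cons)
qed (simp add: closed_length_def)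

text \<open>The first tour is interrupted at \<open>a\<close>, the second is traversed in full from
  \<open>b\<close>, and then the first is resumed.\<close>

lemma merge_tours:
  assumes "a \<in> set xs" "b \<in> set ys"
  obtains zs where "set zs = set xs \<union> set ys" "length zs = length xs + length ys"
    "closed_length d zs \<le> closed_length d xs + closed_length d ys + 2 * d a b"
proof -
  obtain us vs where xs: "xs = us @ a # vs" using assms(1) by (auto simp: in_set_conv_decomp)
  obtain ps qs where ys: "ys = ps @ b # qs" using assms(2) by (auto simp: in_set_conv_decomp)
  define h where "h = hd (us @ [a])"
  define zs where "zs = us @ a # b # qs @ ps @ vs"
  have hd: "hd xs = h" "hd zs = h" unfolding xs zs_def h_def by (cases us; simp)+
  have "closed_length d zs = walk_length d (us @ [a]) + walk_length d (a # b # qs @ ps @ vs @ [h])"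
    unfolding closed_length_def hd using walk_length_split[of d us a "b # qs @ ps @ vs @ [h]"]
    by (simp add: zs_def)
  \<comment> \<open>Inserting second visits to \<open>b\<close> and \<open>a\<close> can only
    lengthen the walk; afterwards it splits exactly into the two tours and the connecting edge,
    taken once in each direction.\<close>
  also have "walk_length d (a # b # qs @ ps @ vs @ [h]) \<le> walk_length d (a # b # qs @ ps @ b # vs @ [h])"
    using walk_length_delete[of "a # b # qs @ ps" "vs @ [h]" b] by simp
  also have "\<dots> \<le> walk_length d (a # b # qs @ ps @ b # a # vs @ [h])"
    using walk_length_delete[of "a # b # qs @ ps @ [b]" "vs @ [h]" a] by simp
  also have "\<dots> = d a b + walk_length d (b # qs @ ps @ [b]) + d b a + walk_length d (a # vs @ [h])"
    using walk_length_split[of d "a # b # qs @ ps" b "a # vs @ [h]"] by simp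
  also have "walk_length d (b # qs @ ps @ [b]) = closed_length d ys"
    unfolding ys closed_length_rotate ..
  also have "walk_length d (us @ [a]) + (d a b + closed_length d ys + d b a + walk_length d (a # vs @ [h]))
      = closed_length d xs + closed_length d ys + 2 * d a b"
    unfolding closed_length_def[of d xs] hd using walk_length_split[of d us a "vs @ [h]"] commute[of b a]
    by (simp add: xs)
  finally have "closed_length d zs \<le> closed_length d xs + closed_length d ys + 2 * d a b"
    by simp
  moreover have "set zs = set xs \<union> set ys" "length zs = length xs + length ys"
    unfolding zs_def xs ys by auto
  ultimately show thesis using that by blast
qed

text \<open>The merged part grows by one tour at a time, much as in Prim's algorithm:
  \<open>link\<close> supplies a short edge out of every proper nonempty part.\<close>

lemma merge_connected_tours:
  assumes "finite V" "V \<noteq> {}" "0 \<le> c"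
    and link: "\<And>X. X \<subseteq> V \<Longrightarrow> X \<noteq> {} \<Longrightarrow> X \<noteq> V \<Longrightarrow>
      \<exists>v\<in>X. \<exists>w\<in>V - X. \<exists>a\<in>set (f v). \<exists>b\<in>set (f w). d a b \<le> c"
  obtains zs where "set zs = (\<Union>v\<in>V. set (f v))" "length zs = (\<Sum>v\<in>V. length (f v))"
    "closed_length d zs \<le> (\<Sum>v\<in>V. closed_length d (f v) + 2 * c)"
proof -
  have "\<exists>X zs. X \<subseteq> V \<and> card X = Suc n \<and> set zs = (\<Union>v\<in>X. set (f v)) \<and> length zs = (\<Sum>v\<in>X. length (f v))
      \<and> closed_length d zs \<le> (\<Sum>v\<in>X. closed_length d (f v) + 2 * c)"
    if "Suc n \<le> card V" for n
    using that
  proof (induction n)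
    case 0
    obtain v where "v \<in> V" using assms(2) by blast
    then show ?case using assms(3) by (intro exI[of _ "{v}"] exI[of _ "f v"]) auto
  next
    case (Suc n)
    then obtain X zs where X: "X \<subseteq> V" "card X = Suc n" and zs: "set zs = (\<Union>v\<in>X. set (f v))"
      "length zs = (\<Sum>v\<in>X. length (f v))"
      "closed_length d zs \<le> (\<Sum>v\<in>X. closed_length d (f v) + 2 * c)"
      by auto
    have "X \<noteq> {}" "X \<noteq> V" using X Suc.prems by auto
    then obtain v w a b where vw: "v \<in> X" "w \<in> V - X" "a \<in> set (f v)" "b \<in> set (f w)" "d a b \<le> c"
      using link[OF X(1)] by blast
    have "a \<in> set zs" using vw zs by blast
    from merge_tours[OF this vw(4)] obtain us where us: "set us = set zs \<union> set (f w)"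
      "length us = length zs + length (f w)"
      "closed_length d us \<le> closed_length d zs + closed_length d (f w) + 2 * d a b" .
    have fin: "finite X" using X assms(1) finite_subset by blast
    have "closed_length d us \<le> (\<Sum>v\<in>insert w X. closed_length d (f v) + 2 * c)"
      using us(3) zs(3) vw fin by (simp add: algebra_simps)
    moreover have "set us = (\<Union>v\<in>insert w X. set (f v))" "length us = (\<Sum>v\<in>insert w X. length (f v))"
      using us zs vw fin by auto
    moreover have "insert w X \<subseteq> V" "card (insert w X) = Suc (Suc n)" using X vw fin by auto
    ultimately show ?case by blast
  qed
  moreover have "Suc (card V - 1) = card V" using assms(1,2) by (simp add: card_gt_0_iff)
  ultimately obtain X zs where X: "X \<subseteq> V" "card X = card V"
    and zs: "set zs = (\<Union>v\<in>X. set (f v))" "length zs = (\<Sum>v\<in>X. length (f v))"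
      "closed_length d zs \<le> (\<Sum>v\<in>X. closed_length d (f v) + 2 * c)"
    by (metis order_refl)
  have "X = V" using X assms(1) card_subset_eq by blast
  then show thesis using that zs by blast
qed
end

section \<open>Cells and rectangles\<close>

type_synonym cell = "int \<times> int"

definition cell_dist :: "cell \<Rightarrow> cell \<Rightarrow> int" where
  "cell_dist p q = \<bar>fst p - fst q\<bar> + \<bar>snd p - snd q\<bar>"

interpretation cell: semimetric cell_dist
  by unfold_locales (auto simp: cell_dist_def)

definition king_adjacent :: "cell \<Rightarrow> cell \<Rightarrow> bool" where
  "king_adjacent p q \<longleftrightarrow> \<bar>fst p - fst q\<bar> \<le> 1 \<and> \<bar>snd p - snd q\<bar> \<le> 1"

text \<open>Connectivity is phrased by cuts, the form that tour merging and the crossing arguments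
  consume. Diagonal neighbours count because a connected grid may hang together at corners
  only.\<close>

definition king_connected :: "cell set \<Rightarrow> bool" where
  "king_connected Q \<longleftrightarrow>
     (\<forall>X. X \<subseteq> Q \<longrightarrow> X \<noteq> {} \<longrightarrow> X \<noteq> Q \<longrightarrow> (\<exists>p\<in>X. \<exists>q\<in>Q - X. king_adjacent p q))"

text \<open>Changes encode boundary edges: vertical ones here, indexed by the cell on their left,
  and horizontal ones in \<open>ver_changes\<close>, indexed by the cell below.\<close>

definition hor_changes :: "cell set \<Rightarrow> cell set" where
  "hor_changes Q = {(i, j). ((i, j) \<in> Q) \<noteq> ((i + 1, j) \<in> Q)}"

definition ver_changes :: "cell set \<Rightarrow> cell set" where
  "ver_changes Q = {(i, j). ((i, j) \<in> Q) \<noteq> ((i, j + 1) \<in> Q)}"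

lemma finite_changes:
  assumes "finite Q"
  shows "finite (hor_changes Q)" "finite (ver_changes Q)"
proof -
  have "hor_changes Q \<subseteq> Q \<union> (\<lambda>(i, j). (i - 1, j)) ` Q"
    unfolding hor_changes_def by (force simp: image_iff)
  then show "finite (hor_changes Q)" using assms finite_subset by blast
  have "ver_changes Q \<subseteq> Q \<union> (\<lambda>(i, j). (i, j - 1)) ` Q"
    unfolding ver_changes_def by (force simp: image_iff)
  then show "finite (ver_changes Q)" using assms finite_subset by blast
qed

section \<open>Rectangles with few boundary edges\<close>

lemma int_step_change:
  fixes P :: "int \<Rightarrow> bool"
  assumes "P x \<noteq> P y" "x \<in> {a..<b}" "y \<in> {a..<b}"
  obtains i where "i \<in> {a..<b}" "P i \<noteq> P (i + 1)"
proof -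
  have *: "\<exists>i\<in>{a..<b}. P i \<noteq> P (i + 1)"
    if xy: "P x \<noteq> P y" "x \<le> y" "x \<in> {a..<b}" "y \<in> {a..<b}" for x y
  proof (rule ccontr)
    assume n: "\<not> ?thesis"
    have "y < b \<longrightarrow> P y = P x"
      using xy(2)
    proof (induction rule: int_ge_induct)
      case (step i)
      show ?case
      proof
        assume "i + 1 < b"
        then have "i \<in> {a..<b}" "P i = P x" using step xy(3) by auto
        then show "P (i + 1) = P x" using n by metis
      qed
    qed simp
    then show False using xy(1,4) by auto
  qed
  have "\<exists>i\<in>{a..<b}. P i \<noteq> P (i + 1)"
    using *[of x y] *[of y x] assms by (cases "x \<le> y") auto
  then show thesis using that by blast
qed

text \<open>Inside a rectangle, at most one row per horizontal change is neither full nor empty, and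
  likewise for columns. Once one row and one column are pure, they share a cell and hence all pure
  rows and columns have the same colour.\<close>

lemma rectangle_dichotomy:
  assumes "finite Q" and N: "N = {a..<b} \<times> {c..<d}"
    and h: "int (card (hor_changes Q \<inter> N)) < d - c"
    and v: "int (card (ver_changes Q \<inter> N)) < b - a"
  obtains C R where "finite C" "finite R"
    "card C \<le> card (ver_changes Q \<inter> N)" "card R \<le> card (hor_changes Q \<inter> N)"
    "N - Q \<subseteq> C \<times> R \<or> Q \<inter> N \<subseteq> C \<times> R"
proof -
  define R where "R = snd ` (hor_changes Q \<inter> N)"
  define C where "C = fst ` (ver_changes Q \<inter> N)"
  have fin: "finite C" "finite R"
    unfolding R_def C_def using finite_changes[OF assms(1)] by auto
  have card: "card C \<le> card (ver_changes Q \<inter> N)" "card R \<le> card (hor_changes Q \<inter> N)"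
    unfolding R_def C_def using finite_changes[OF assms(1)] by (auto intro!: card_image_le)
  have row: "(x, y) \<in> Q \<longleftrightarrow> (x', y) \<in> Q"
    if xy: "x \<in> {a..<b}" "x' \<in> {a..<b}" "y \<in> {c..<d}" "y \<notin> R" for x x' y
  proof (rule ccontr)
    assume "\<not> ?thesis"
    then obtain i where "i \<in> {a..<b}" "((i, y) \<in> Q) \<noteq> ((i + 1, y) \<in> Q)"
      using int_step_change[of "\<lambda>x. (x, y) \<in> Q" x x' a b] xy by blast
    then have "(i, y) \<in> hor_changes Q \<inter> N" using xy unfolding N hor_changes_def by auto
    then show False using xy unfolding R_def by force
  qed
  have col: "(x, y) \<in> Q \<longleftrightarrow> (x, y') \<in> Q"
    if xy: "x \<in> {a..<b}" "y \<in> {c..<d}" "y' \<in> {c..<d}" "x \<notin> C" for x y y'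
  proof (rule ccontr)
    assume "\<not> ?thesis"
    then obtain i where "i \<in> {c..<d}" "((x, i) \<in> Q) \<noteq> ((x, i + 1) \<in> Q)"
      using int_step_change[of "\<lambda>y. (x, y) \<in> Q" y y' c d] xy by blast
    then have "(x, i) \<in> ver_changes Q \<inter> N" using xy unfolding N ver_changes_def by auto
    then show False using xy unfolding C_def by force
  qed
  \<comment> \<open>There are fewer changes than rows, so some row is pure; the same count below
    yields a pure column.\<close>
  have "\<not> {c..<d} \<subseteq> R"
  proof
    assume "{c..<d} \<subseteq> R"
    then have "card {c..<d} \<le> card R" using fin card_mono by blast
    then show False using card h by simp
  qed
  then obtain y0 where y0: "y0 \<in> {c..<d}" "y0 \<notin> R" by blast
  have "\<not> {a..<b} \<subseteq> C"
  proof
    assume "{a..<b} \<subseteq> C"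
    then have "card {a..<b} \<le> card C" using fin card_mono by blast
    then show False using card v by simp
  qed
  then obtain x0 where x0: "x0 \<in> {a..<b}" "x0 \<notin> C" by blast
  \<comment> \<open>A pure column leads to row \<open>y0\<close> and from there to \<open>x0\<close>
    without a change; a pure row leads to column \<open>x0\<close> and from there to
    \<open>y0\<close>.\<close>
  have same: "(x, y) \<in> Q \<longleftrightarrow> (x0, y0) \<in> Q"
    if "(x, y) \<in> N" "x \<notin> C \<or> y \<notin> R" for x y
    using that(2)
  proof
    assume "x \<notin> C"
    then show ?thesis using that(1) col[of x y y0] row[of x x0 y0] x0 y0 unfolding N by auto
  next
    assume "y \<notin> R"
    then show ?thesis using that(1) row[of x x0 y] col[of x0 y y0] x0 y0 unfolding N by auto
  qed
  have "N - Q \<subseteq> C \<times> R \<or> Q \<inter> N \<subseteq> C \<times> R"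
  proof (cases "(x0, y0) \<in> Q")
    case True
    then have "N - Q \<subseteq> C \<times> R" using same by auto
    then show ?thesis ..
  next
    case False
    then have "Q \<inter> N \<subseteq> C \<times> R" using same by auto
    then show ?thesis ..
  qed
  then show thesis using that fin card by blast
qed

text \<open>Tiles are squares of \<open>g \<times> g\<close> cells, blocks are squares of \<open>72 \<times> 72\<close> tiles, and \<open>nbhd g r B\<close>
  consists of the blocks at Chebyshev distance at most \<open>r\<close> from the block with index \<open>B\<close>.\<close>

definition tile :: "int \<Rightarrow> cell \<Rightarrow> cell set" where
  "tile g t = {g * fst t..<g * (fst t + 1)} \<times> {g * snd t..<g * (snd t + 1)}"

definition nbhd :: "int \<Rightarrow> int \<Rightarrow> cell \<Rightarrow> cell set" where
  "nbhd g r B = {72 * g * (fst B - r)..<72 * g * (fst B + r + 1)}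
     \<times> {72 * g * (snd B - r)..<72 * g * (snd B + r + 1)}"

lemma interval_div_iff:
  fixes a b w x :: int
  assumes "w > 0"
  shows "x \<in> {w * a..<w * b} \<longleftrightarrow> a \<le> x div w \<and> x div w < b"
proof -
  have "w * c \<le> x \<longleftrightarrow> c \<le> x div w" for c
  proof
    assume "w * c \<le> x"
    then show "c \<le> x div w" using zdiv_mono1[of "w * c" x w] assms by simp
  next
    assume "c \<le> x div w"
    then have "w * c \<le> w * (x div w)" using assms by simp
    also have "\<dots> \<le> x" using assms by (metis add.right_neutral add_left_mono mult_div_mod_eq pos_mod_sign)
    finally show "w * c \<le> x" .
  qed
  from this[of a] this[of b] show ?thesis by auto
qed

section \<open>Poor and rich blocks\<close>

lemma king_connected_crossing:
  assumes "king_connected Q" "Q \<inter> X \<noteq> {}" "\<not> Q \<subseteq> X"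
  obtains p q where "p \<in> Q \<inter> X" "q \<in> Q - X" "king_adjacent p q"
proof -
  have "Q \<inter> X \<subseteq> Q" "Q \<inter> X \<noteq> {}" "Q \<inter> X \<noteq> Q" using assms(2,3) by auto
  then obtain p q where "p \<in> Q \<inter> X" "q \<in> Q - Q \<inter> X" "king_adjacent p q"
    using assms(1) unfolding king_connected_def by meson
  then show thesis using that by blast
qed

text \<open>The main case, where \<open>Q\<close> does not fit into a 5 by 5 array of blocks; the
  opposite case is settled directly in \<open>tile_tour\<close>.\<close>

locale spread_cells =
  fixes Q :: "cell set" and g :: int
  assumes finite_cells: "finite Q" and connected_cells: "king_connected Q" and g_pos: "0 < g"
    and spread: "\<And>B. \<not> Q \<subseteq> nbhd g 2 B"
begin

text \<open>The margin of one block is needed because a cell may be covered by a lattice stop that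
  belongs to a neighbouring block.\<close>

definition active :: "cell set" where
  "active = {B. Q \<inter> nbhd g 1 B \<noteq> {}}"

text \<open>Radius 2 leaves a ring one block wide around the neighbourhood used in
  \<open>active\<close>; \<open>crossing_needs_lines\<close> works in this ring.\<close>

definition changes_near :: "cell \<Rightarrow> nat" where
  "changes_near B = card (hor_changes Q \<inter> nbhd g 2 B) + card (ver_changes Q \<inter> nbhd g 2 B)"

text \<open>The threshold \<open>g\<close> serves both sides: fewer changes leave fewer cells
  missing than a single tile contains, while \<open>g\<close> or more changes pay for extra stops of
  number O(1).\<close>

definition rich :: "cell set" where
  "rich = {B \<in> active. g \<le> int (changes_near B)}"

definition poor :: "cell set" where
  "poor = active - rich"

definition block_of :: "cell \<Rightarrow> cell" where
  "block_of q = (fst q div (72 * g), snd q div (72 * g))"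

definition tile_of :: "cell \<Rightarrow> cell" where
  "tile_of q = (fst q div g, snd q div g)"

lemma nbhd_iff:
  "q \<in> nbhd g r B \<longleftrightarrow> \<bar>fst (block_of q) - fst B\<bar> \<le> r \<and> \<bar>snd (block_of q) - snd B\<bar> \<le> r"
proof -
  obtain x y where q: "q = (x, y)" by (cases q)
  have "0 < 72 * g" using g_pos by simp
  from interval_div_iff[OF this, of x] interval_div_iff[OF this, of y] show ?thesis
    unfolding nbhd_def block_of_def q mem_Times_iff fst_conv snd_conv by (simp only:) auto
qed

lemma tile_iff: "q \<in> tile g t \<longleftrightarrow> tile_of q = t"
proof -
  obtain x y where q: "q = (x, y)" by (cases q)
  from interval_div_iff[OF g_pos, of x] interval_div_iff[OF g_pos, of y] show ?thesis
    unfolding tile_def tile_of_def q mem_Times_iff fst_conv snd_conv by (simp only:) (cases t; auto)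
qed

lemma block_of_tile: "block_of q = (fst (tile_of q) div 72, snd (tile_of q) div 72)"
  unfolding block_of_def tile_of_def using zdiv_zmult2_eq[of 72] by (simp add: mult.commute)

lemma nbhd_mono: "r \<le> s \<Longrightarrow> nbhd g r B \<subseteq> nbhd g s B"
  by (auto simp: nbhd_iff)

text \<open>If \<open>Q\<close> meets the inner neighbourhood but leaves the outer one, it contains a cell at every
  intermediate Chebyshev distance, so it cannot be confined to few rows and few columns.\<close>

lemma crossing_needs_lines:
  assumes "Q \<inter> nbhd g 1 B \<noteq> {}" "Q \<inter> nbhd g 2 B \<subseteq> C \<times> R" "finite C" "finite R"
  shows "72 * g \<le> int (card C + card R)"
proof -
  define w where "w = 72 * g"
  have w: "w > 0" using g_pos by (simp add: w_def)
  \<comment> \<open>\<open>far b x\<close> is the distance of \<open>x\<close> from the coordinate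
    range of the inner neighbourhood, so the larger of its values in the two coordinates is the
    Chebyshev distance. Each value from 1 to \<open>w\<close> will be attained on a line of
    \<open>C\<close> or \<open>R\<close>.\<close>
  define far where "far b x = max 0 (max (w * (b - 1) - x) (x - (w * (b + 2) - 1)))" for b x :: int
  have "r \<in> far (fst B) ` C \<union> far (snd B) ` R" if r: "r \<in> {1..w}" for r
  proof -
    define X where "X = {q. far (fst B) (fst q) < r \<and> far (snd B) (snd q) < r}"
    have sub: "X \<subseteq> nbhd g 2 B"
      using r unfolding X_def far_def nbhd_def w_def[symmetric] by (auto simp: algebra_simps)
    have "nbhd g 1 B \<subseteq> X"
      using r unfolding X_def far_def nbhd_def w_def[symmetric] by (auto simp: algebra_simps)
    then have "Q \<inter> X \<noteq> {}" using assms(1) by blast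
    moreover have "\<not> Q \<subseteq> X" using spread[of B] sub by blast
    ultimately obtain p q where pq: "p \<in> Q \<inter> X" "q \<in> Q - X" "king_adjacent p q"
      using king_connected_crossing[OF connected_cells] by blast
    \<comment> \<open>A king step changes \<open>far\<close> by at most 1, so a cell reached on
      leaving \<open>X\<close> is at distance exactly \<open>r\<close>.\<close>
    have far1: "far b x \<le> far b y + 1" if "\<bar>y - x\<bar> \<le> 1" for b x y
      using that unfolding far_def by auto
    have q: "far (fst B) (fst q) \<le> r" "far (snd B) (snd q) \<le> r"
      "far (fst B) (fst q) = r \<or> far (snd B) (snd q) = r"
      using pq far1[of "fst p" "fst q" "fst B"] far1[of "snd p" "snd q" "snd B"]
      unfolding X_def king_adjacent_def by auto
    then have "q \<in> nbhd g 2 B"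
      using r unfolding far_def nbhd_def w_def[symmetric] mem_Times_iff
      by (auto simp: algebra_simps)
    then have "fst q \<in> C" "snd q \<in> R" using pq assms(2) by auto
    then show ?thesis using q(3) by blast
  qed
  then have "card {1..w} \<le> card (far (fst B) ` C \<union> far (snd B) ` R)"
    using assms(3,4) by (intro card_mono finite_UnI finite_imageI subsetI)
  also have "\<dots> \<le> card (far (fst B) ` C) + card (far (snd B) ` R)" by (rule card_Un_le)
  also have "\<dots> \<le> card C + card R" using assms by (intro add_mono card_image_le) auto
  finally show ?thesis using w unfolding w_def by simp
qed

text \<open>\<open>rectangle_dichotomy\<close> makes the neighbourhood almost full or almost empty.
  The second is impossible: confining \<open>Q\<close> there would take \<open>72 * g\<close> lines
  by \<open>crossing_needs_lines\<close>, but fewer than \<open>2 * g\<close> are available.\<close>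

lemma poor_deficit:
  assumes "B \<in> poor"
  obtains D where "finite D" "int (card D) < g * g" "nbhd g 2 B - Q \<subseteq> D"
proof -
  have act: "Q \<inter> nbhd g 1 B \<noteq> {}" and few: "int (changes_near B) < g"
    using assms unfolding poor_def rich_def active_def by auto
  have "\<exists>C R. finite C \<and> finite R \<and> card C \<le> card (ver_changes Q \<inter> nbhd g 2 B)
      \<and> card R \<le> card (hor_changes Q \<inter> nbhd g 2 B)
      \<and> (nbhd g 2 B - Q \<subseteq> C \<times> R \<or> Q \<inter> nbhd g 2 B \<subseteq> C \<times> R)"
    by (rule rectangle_dichotomy[OF finite_cells nbhd_def])
      (use few g_pos in \<open>auto simp: changes_near_def algebra_simps\<close>)
  then obtain C R where CR: "finite C" "finite R" "int (card C) < g" "int (card R) < g"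
      "nbhd g 2 B - Q \<subseteq> C \<times> R \<or> Q \<inter> nbhd g 2 B \<subseteq> C \<times> R"
    using few unfolding changes_near_def by (smt (verit) of_nat_add of_nat_mono of_nat_0_le_iff)
  then have "nbhd g 2 B - Q \<subseteq> C \<times> R"
    using crossing_needs_lines[OF act, of C R] g_pos by auto
  moreover have "int (card (C \<times> R)) < g * g"
  proof -
    have "int (card C) * int (card R) \<le> int (card C) * g" using CR by (intro mult_left_mono) auto
    also have "\<dots> < g * g" using CR g_pos by simp
    finally show ?thesis by (simp add: card_cartesian_product)
  qed
  ultimately show thesis using that[of "C \<times> R"] CR(1,2) by simp
qed

text \<open>Pigeonhole: a tile has \<open>g * g\<close> cells, more than the deficit. Hence lattice
  stops of poor blocks can be moved into \<open>Q\<close> within their tiles.\<close>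

lemma poor_tile:
  assumes "B \<in> poor" "tile g t \<subseteq> nbhd g 2 B"
  shows "Q \<inter> tile g t \<noteq> {}"
proof
  assume "Q \<inter> tile g t = {}"
  obtain D where D: "finite D" "int (card D) < g * g" "nbhd g 2 B - Q \<subseteq> D"
    using poor_deficit[OF assms(1)] .
  have "tile g t \<subseteq> D" using assms \<open>Q \<inter> tile g t = {}\<close> D by blast
  then have "card (tile g t) \<le> card D" using D card_mono by blast
  moreover have "int (card (tile g t)) = g * g"
    using g_pos unfolding tile_def by (simp add: card_cartesian_product algebra_simps)
  ultimately show False using D by linarith
qed

text \<open>A block has 72 * 72 = 5184 tiles and lacks less than one tile's worth of cells.\<close>

lemma poor_area:
  assumes "B \<in> poor"
  shows "5183 * (g * g) \<le> int (card (Q \<inter> nbhd g 0 B))"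
proof -
  obtain D where D: "finite D" "int (card D) < g * g" "nbhd g 2 B - Q \<subseteq> D"
    using poor_deficit[OF assms(1)] .
  have "nbhd g 0 B \<subseteq> (Q \<inter> nbhd g 0 B) \<union> D" using D nbhd_mono[of 0 2 B] by auto
  then have "card (nbhd g 0 B) \<le> card ((Q \<inter> nbhd g 0 B) \<union> D)"
    using D finite_cells by (intro card_mono) auto
  also have "\<dots> \<le> card (Q \<inter> nbhd g 0 B) + card D" by (rule card_Un_le)
  finally have "card (nbhd g 0 B) \<le> card (Q \<inter> nbhd g 0 B) + card D" .
  moreover have "int (card (nbhd g 0 B)) = 5184 * (g * g)"
    using g_pos unfolding nbhd_def by (simp add: card_cartesian_product algebra_simps)
  ultimately show ?thesis using D by linarith
qed

section \<open>Connectedness of the active blocks\<close>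

lemma active_iff: "B \<in> active \<longleftrightarrow> (\<exists>q\<in>Q. king_adjacent (block_of q) B)"
  unfolding active_def king_adjacent_def by (auto simp: nbhd_iff)

lemma finite_active: "finite active"
proof -
  have "active \<subseteq> (\<Union>q\<in>Q. {fst (block_of q) - 1..fst (block_of q) + 1} \<times> {snd (block_of q) - 1..snd (block_of q) + 1})"
    unfolding active_iff king_adjacent_def subset_iff by (auto simp: abs_le_iff) force
  then show ?thesis by (rule finite_subset) (use finite_cells in auto)
qed

text \<open>The block of a cell of \<open>Q\<close> and all its king neighbours are active, so they
  lie on the same side of a separation. Sorting cells by the side of their block would then separate
  \<open>Q\<close>, whose king steps lead only to equal or adjacent blocks.\<close>

lemma king_connected_active: "king_connected active"
  unfolding king_connected_def
proof (intro allI impI, rule ccontr)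
  fix X assume X: "X \<subseteq> active" "X \<noteq> {}" "X \<noteq> active"
    and sep: "\<not> (\<exists>p\<in>X. \<exists>q\<in>active - X. king_adjacent p q)"
  have blk: "king_adjacent (block_of q) B \<Longrightarrow> B \<in> active \<and> (block_of q \<in> X \<longleftrightarrow> B \<in> X)" if "q \<in> Q" for q B
  proof -
    assume adj: "king_adjacent (block_of q) B"
    then have adj': "king_adjacent B (block_of q)" unfolding king_adjacent_def by auto
    have "king_adjacent (block_of q) (block_of q)" unfolding king_adjacent_def by auto
    then have "block_of q \<in> active" "B \<in> active" using adj that unfolding active_iff by auto
    then show ?thesis using sep adj adj' by blast
  qed
  obtain B where "B \<in> X" using X by blast
  then obtain q where "q \<in> Q" "king_adjacent (block_of q) B" using X active_iff by blast
  then have 1: "Q \<inter> {q. block_of q \<in> X} \<noteq> {}" using blk \<open>B \<in> X\<close> by blast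
  obtain B' where "B' \<in> active - X" using X by blast
  then obtain q where "q \<in> Q" "king_adjacent (block_of q) B'" using active_iff by blast
  then have 2: "\<not> Q \<subseteq> {q. block_of q \<in> X}" using blk \<open>B' \<in> active - X\<close> by blast
  obtain p q where pq: "p \<in> Q" "block_of p \<in> X" "q \<in> Q" "block_of q \<notin> X" "king_adjacent p q"
    using king_connected_crossing[OF connected_cells 1 2] by blast
  have near: "\<bar>x div w - y div w\<bar> \<le> 1" if "\<bar>x - y\<bar> \<le> 1" "0 < w" for x y w :: int
  proof -
    have "x \<le> y + w" "y \<le> x + w" using that by auto
    then have "x div w \<le> (y + w) div w" "y div w \<le> (x + w) div w"
      using zdiv_mono1[OF _ that(2)] by blast+
    then show ?thesis using that(2) by auto
  qed
  have "king_adjacent (block_of p) (block_of q)"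
    using pq(5) near[of _ _ "72 * g"] g_pos unfolding king_adjacent_def block_of_def by simp
  then show False using blk[OF pq(1)] pq by blast
qed

text \<open>This makes every run of poor blocks end, on its right, at a rich block.\<close>

lemma right_of_poor_active:
  assumes "(i, j) \<in> poor"
  shows "(i + 1, j) \<in> active"
proof -
  have "0 < int (card (Q \<inter> nbhd g 0 (i, j)))"
    using poor_area[OF assms] g_pos by (smt (verit) mult_pos_pos)
  then have "Q \<inter> nbhd g 0 (i, j) \<noteq> {}" by auto
  moreover have "nbhd g 0 (i, j) \<subseteq> nbhd g 1 (i + 1, j)" using nbhd_iff by auto
  ultimately show ?thesis unfolding active_def by blast
qed

section \<open>Counting poor and rich blocks\<close>

lemma card_poor: "5183 * (g * g) * int (card poor) \<le> int (card Q)"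
proof -
  have fin: "finite poor" using finite_active unfolding poor_def by auto
  have "5183 * (g * g) * int (card poor) = (\<Sum>B\<in>poor. 5183 * (g * g))" by simp
  also have "\<dots> \<le> (\<Sum>B\<in>poor. int (card (Q \<inter> nbhd g 0 B)))" by (rule sum_mono) (rule poor_area)
  also have "\<dots> = int (card (\<Union>B\<in>poor. Q \<inter> nbhd g 0 B))"
  proof -
    have "card (\<Union>B\<in>poor. Q \<inter> nbhd g 0 B) = (\<Sum>B\<in>poor. card (Q \<inter> nbhd g 0 B))"
      using fin finite_cells nbhd_iff[of _ 0] by (intro card_UN_disjoint) (auto simp: prod_eq_iff)
    then show ?thesis by simp
  qed
  also have "\<dots> \<le> int (card Q)" using finite_cells by (simp add: card_mono UN_least)
  finally show ?thesis .
qed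

text \<open>Double counting: each change lies in the radius 2 neighbourhood of at most 25
  blocks.\<close>

lemma card_rich: "g * int (card rich) \<le> 25 * int (card (hor_changes Q) + card (ver_changes Q))"
proof -
  have fin: "finite rich" using finite_active unfolding rich_def by auto
  have overlap: "(\<Sum>B\<in>rich. card (E \<inter> nbhd g 2 B)) \<le> 25 * card E" if "finite E" for E
  proof -
    have "(\<Sum>B\<in>rich. card (E \<inter> nbhd g 2 B)) = (\<Sum>B\<in>rich. \<Sum>e\<in>E. if e \<in> nbhd g 2 B then 1 else 0)"
      using that by (simp add: sum.If_cases Int_def)
    also have "\<dots> = (\<Sum>e\<in>E. \<Sum>B\<in>rich. if e \<in> nbhd g 2 B then 1 else 0)" by (rule sum.swap)
    also have "\<dots> \<le> (\<Sum>e\<in>E. 25)"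
    proof (rule sum_mono)
      fix e
      have "{B \<in> rich. e \<in> nbhd g 2 B} \<subseteq> {fst (block_of e) - 2..fst (block_of e) + 2} \<times> {snd (block_of e) - 2..snd (block_of e) + 2}"
        using nbhd_iff by (auto simp: abs_le_iff)
      from card_mono[OF _ this] have "card {B \<in> rich. e \<in> nbhd g 2 B} \<le> 25"
        by (simp add: card_cartesian_product)
      then show "(\<Sum>B\<in>rich. if e \<in> nbhd g 2 B then 1 else 0) \<le> (25::nat)"
        using fin by (simp add: sum.If_cases Int_def)
    qed
    finally show ?thesis by simp
  qed
  have "g * int (card rich) = (\<Sum>B\<in>rich. g)" by simp
  also have "\<dots> \<le> (\<Sum>B\<in>rich. int (changes_near B))" by (rule sum_mono) (simp add: rich_def)
  also have "\<dots> = int ((\<Sum>B\<in>rich. card (hor_changes Q \<inter> nbhd g 2 B)) + (\<Sum>B\<in>rich. card (ver_changes Q \<inter> nbhd g 2 B)))"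
    by (simp add: changes_near_def sum.distrib)
  also have "\<dots> \<le> int (25 * card (hor_changes Q) + 25 * card (ver_changes Q))"
    using overlap finite_changes[OF finite_cells] by (simp only: of_nat_le_iff add_mono)
  finally show ?thesis by simp
qed

end

section \<open>Loops of stops\<close>

text \<open>Coordinates are tile indices. Stops are 24 tiles apart, rows 36 apart and staggered by
  12. The lower row is listed rightwards and the upper row leftwards, in the order of
  traversal.\<close>

definition lower_stops :: "cell \<Rightarrow> cell list" where
  "lower_stops B = [(72 * fst B, 72 * snd B), (72 * fst B + 24, 72 * snd B), (72 * fst B + 48, 72 * snd B)]"

definition upper_stops :: "cell \<Rightarrow> cell list" where
  "upper_stops B = [(72 * fst B + 60, 72 * snd B + 36), (72 * fst B + 36, 72 * snd B + 36),
     (72 * fst B + 12, 72 * snd B + 36)]"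

text \<open>The distances from a point to the nearest stops of the two adjacent stop rows add up to
  \<open>12\<close> horizontally, because the rows are staggered, and to \<open>36\<close> vertically.\<close>

lemma stops_cover_plane:
  obtains B s where "s \<in> set (lower_stops B) \<union> set (upper_stops B)" "cell_dist t s \<le> 24"
proof -
  obtain x y where t: "t = (x, y)" by (cases t)
  \<comment> \<open>Column \<open>24 * a\<close> holds a nearest stop of a lower row, column
    \<open>24 * b + 12\<close> one of an upper row.\<close>
  define a b where "a = (x + 12) div 24" and "b = x div 24"
  have ab: "\<bar>x - 24 * a\<bar> + \<bar>x - (24 * b + 12)\<bar> = 12"
  proof -
    have "24 * b \<le> x" "x < 24 * b + 24" unfolding b_def by presburger+
    moreover have "24 * a \<le> x + 12" "x + 12 < 24 * a + 24" unfolding a_def by presburger+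
    ultimately have "a = b \<and> x < 24 * b + 12 \<or> a = b + 1 \<and> x \<ge> 24 * b + 12" by linarith
    then show ?thesis using \<open>24 * b \<le> x\<close> \<open>x < 24 * b + 24\<close> by auto
  qed
  have low: "(24 * c, 72 * j) \<in> set (lower_stops (c div 3, j))" for c j :: int
  proof -
    define e where "e = c div 3"
    have "c = 3 * e \<or> c = 3 * e + 1 \<or> c = 3 * e + 2" unfolding e_def by presburger
    then show ?thesis unfolding e_def[symmetric] lower_stops_def by auto
  qed
  have up: "(24 * c + 12, 72 * j + 36) \<in> set (upper_stops (c div 3, j))" for c j :: int
  proof -
    define e where "e = c div 3"
    have "c = 3 * e \<or> c = 3 * e + 1 \<or> c = 3 * e + 2" unfolding e_def by presburger
    then show ?thesis unfolding e_def[symmetric] upper_stops_def by auto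
  qed
  define j where "j = y div 72"
  have y: "72 * j \<le> y" "y < 72 * j + 72" unfolding j_def by presburger+
  have "\<bar>x - 24 * a\<bar> + \<bar>y - 72 * j\<bar> \<le> 24 \<or> \<bar>x - (24 * b + 12)\<bar> + \<bar>y - (72 * j + 36)\<bar> \<le> 24
      \<or> \<bar>x - 24 * a\<bar> + \<bar>y - 72 * (j + 1)\<bar> \<le> 24"
  \<comment> \<open>In either half of the block row, the distances to the two enclosing rows of
    stops add up to 12 + 36 = 48, so one is at most 24.\<close>
  proof (cases "y < 72 * j + 36")
    case True
    then have "\<bar>y - 72 * j\<bar> + \<bar>y - (72 * j + 36)\<bar> = 36" using y by auto
    then show ?thesis using ab by linarith
  next
    case False
    then have "\<bar>y - (72 * j + 36)\<bar> + \<bar>y - 72 * (j + 1)\<bar> = 36" using y by auto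
    then show ?thesis using ab by linarith
  qed
  then show thesis
    using that[of "(24 * a, 72 * j)"] that[of "(24 * b + 12, 72 * j + 36)"]
      that[of "(24 * a, 72 * (j + 1))"] low[of a j] up[of b j] low[of a "j + 1"]
    unfolding cell_dist_def t by fastforce
qed

lemma stops_in_block:
  assumes "s \<in> set (lower_stops B) \<union> set (upper_stops B)"
  shows "fst s \<in> {72 * fst B..72 * fst B + 60}" "snd s \<in> {72 * snd B..72 * snd B + 36}"
  using assms unfolding lower_stops_def upper_stops_def by auto

context spread_cells
begin

text \<open>Lattice stops of a rich block may fall into tiles that miss \<open>Q\<close>. Visiting
  every occupied tile of the surrounding 3 by 3 array of blocks covers all cells for which those
  stops were responsible.\<close>

definition hub_tiles :: "cell \<Rightarrow> cell set" where
  "hub_tiles R = {t. Q \<inter> tile g t \<noteq> {}} \<inter>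
     ({72 * (fst R - 1)..<72 * (fst R + 2)} \<times> {72 * (snd R - 1)..<72 * (snd R + 2)})"

text \<open>The order is immaterial, since the hub has bounded size and diameter.\<close>

definition hub :: "cell \<Rightarrow> cell list" where
  "hub R = (SOME ts. set ts = hub_tiles R \<and> distinct ts)"

text \<open>Each step wraps the next block to the left around the list, so that lower rows lead
  towards the hub and upper rows lead back.\<close>

fun loop :: "cell \<Rightarrow> nat \<Rightarrow> cell list" where
  "loop R 0 = hub R"
| "loop R (Suc n) = lower_stops (fst R - int n - 1, snd R) @ loop R n @ upper_stops (fst R - int n - 1, snd R)"

text \<open>The length of the run of poor blocks directly to the left of \<open>R\<close>; the
  minimum exists by \<open>poor_ray_ends\<close>.\<close>

definition run :: "cell \<Rightarrow> nat" where
  "run R = (LEAST n. (fst R - int n - 1, snd R) \<notin> poor)"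

lemma hub: "set (hub R) = hub_tiles R" "length (hub R) \<le> 46656"
proof -
  have "finite (hub_tiles R)" unfolding hub_tiles_def by auto
  from finite_distinct_list[OF this] have *: "set (hub R) = hub_tiles R \<and> distinct (hub R)"
    unfolding hub_def by (rule someI_ex)
  then show "set (hub R) = hub_tiles R" ..
  have "card (hub_tiles R) \<le> card ({72 * (fst R - 1)..<72 * (fst R + 2)} \<times> {72 * (snd R - 1)..<72 * (snd R + 2)})"
    unfolding hub_tiles_def by (intro card_mono) auto
  also have "\<dots> = 46656" by (simp add: card_cartesian_product)
  finally show "length (hub R) \<le> 46656" using * distinct_card by metis
qed

lemma hub_nonempty:
  assumes "R \<in> active"
  shows "hub R \<noteq> []"
proof -
  obtain q where "q \<in> Q" "q \<in> nbhd g 1 R" using assms unfolding active_def by blast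
  have "fst (tile_of q) \<in> {72 * (fst R - 1)..<72 * (fst R + 2)}" "snd (tile_of q) \<in> {72 * (snd R - 1)..<72 * (snd R + 2)}"
    using \<open>q \<in> nbhd g 1 R\<close>
    unfolding nbhd_iff block_of_tile interval_div_iff[OF zero_less_numeral] by auto
  moreover have "q \<in> Q \<inter> tile g (tile_of q)" using \<open>q \<in> Q\<close> tile_iff by blast
  ultimately have "tile_of q \<in> hub_tiles R"
    unfolding hub_tiles_def mem_Times_iff Int_iff by blast
  then show ?thesis using hub(1)[of R] by auto
qed

lemma length_loop: "length (loop R n) = length (hub R) + 6 * n"
  by (induction n) (auto simp: lower_stops_def upper_stops_def)

lemma set_loop:
  "set (loop R n) = hub_tiles R \<union> (\<Union>m<n. set (lower_stops (fst R - int m - 1, snd R)) \<union> set (upper_stops (fst R - int m - 1, snd R)))"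
  by (induction n) (auto simp: hub(1) lessThan_Suc)

text \<open>Each block adds 72 tiles on the way to the hub and 72 on the way back; the constant
  covers the hub.\<close>

lemma loop_closed_length:
  assumes "R \<in> active"
  shows "closed_length cell_dist (loop R n) \<le> 144 * int n + 20160000"
proof -
  define low where "low n = (72 * (fst R - int n), 72 * snd R)" for n
  define up where "up n = (72 * (fst R - int n) + 12, 72 * snd R + 36)" for n
  have ne: "loop R n \<noteq> []" for n by (cases n) (auto simp: hub_nonempty[OF assms] lower_stops_def)
  \<comment> \<open>The induction also carries the legs from \<open>low n\<close> to the head and
    from the last entry to \<open>up n\<close>. The base case is 46656 legs of at most 432 = 2 * 216
    tiles in the hub, and two more such legs.\<close>
  have *: "walk_length cell_dist (loop R n) + cell_dist (low n) (hd (loop R n))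
      + cell_dist (last (loop R n)) (up n) \<le> 144 * int n + 20157000" for n
  proof (induction n)
    case 0
    have box: "fst t \<in> {72 * (fst R - 1)..<72 * (fst R + 2)}" "snd t \<in> {72 * (snd R - 1)..<72 * (snd R + 2)}"
      if "t \<in> set (hub R)" for t
      using that unfolding hub(1) hub_tiles_def by auto
    have "cell_dist s t \<le> 432" if "s \<in> set (hub R)" "t \<in> set (hub R)" for s t
      using box[OF that(1)] box[OF that(2)] unfolding cell_dist_def by auto
    from walk_length_bound[of "hub R" cell_dist, OF this]
    have "walk_length cell_dist (hub R) \<le> int (length (hub R)) * 432" by simp
    moreover have "hd (hub R) \<in> set (hub R)" "last (hub R) \<in> set (hub R)"
      using hub_nonempty[OF assms] by auto
    then have "cell_dist (low 0) (hd (hub R)) \<le> 432" "cell_dist (last (hub R)) (up 0) \<le> 432"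
      using box[of "hd (hub R)"] box[of "last (hub R)"] unfolding cell_dist_def low_def up_def by auto
    ultimately show ?case using hub(2)[of R] by simp
  next
    case (Suc n)
    let ?l = "lower_stops (fst R - int n - 1, snd R)" and ?u = "upper_stops (fst R - int n - 1, snd R)"
    have lu: "?l \<noteq> []" "?u \<noteq> []" "hd ?l = low (Suc n)" "last ?u = up (Suc n)"
      unfolding lower_stops_def upper_stops_def low_def up_def by auto
    have w: "walk_length cell_dist ?l = 48" "walk_length cell_dist ?u = 48"
      unfolding lower_stops_def upper_stops_def cell_dist_def by auto
    have "cell_dist (last ?l) (low n) = 24" "cell_dist (up n) (hd ?u) = 24"
      unfolding lower_stops_def upper_stops_def cell_dist_def low_def up_def by auto
    then have "cell_dist (last ?l) (hd (loop R n)) \<le> 24 + cell_dist (low n) (hd (loop R n))"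
      "cell_dist (last (loop R n)) (hd ?u) \<le> cell_dist (last (loop R n)) (up n) + 24"
      using cell.triangle[of "last ?l" "hd (loop R n)" "low n"] cell.triangle[of "last (loop R n)" "hd ?u" "up n"]
      by auto
    moreover have "cell_dist (low (Suc n)) (hd (loop R (Suc n))) = 0" "cell_dist (last (loop R (Suc n))) (up (Suc n)) = 0"
      using lu unfolding cell_dist_def by auto
    moreover have "walk_length cell_dist (loop R (Suc n)) = 96 + cell_dist (last ?l) (hd (loop R n))
        + walk_length cell_dist (loop R n) + cell_dist (last (loop R n)) (hd ?u)"
      using lu ne[of n] w by (simp add: walk_length_append)
    ultimately show ?case using Suc.IH by simp
  qed
  have "closed_length cell_dist (loop R n) = walk_length cell_dist (loop R n) + cell_dist (last (loop R n)) (hd (loop R n))"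
    unfolding closed_length_def using ne[of n] by (simp add: walk_length_append)
  moreover have "cell_dist (up n) (low n) = 48" unfolding cell_dist_def up_def low_def by simp
  ultimately show ?thesis
    using *[of n] cell.triangle[of "last (loop R n)" "hd (loop R n)" "up n"]
      cell.triangle[of "up n" "hd (loop R n)" "low n"] by linarith
qed

section \<open>Runs of poor blocks\<close>

lemma finite_poor: "finite poor" and finite_rich: "finite rich"
  using finite_active unfolding poor_def rich_def by auto

lemma poor_ray_ends:
  assumes "c = 1 \<or> c = -1"
  obtains n :: nat where "(i + c * int n, j) \<notin> poor"
proof (rule ccontr)
  assume "\<not> thesis"
  then have "range (\<lambda>n. (i + c * int n, j)) \<subseteq> poor" using that by blast
  then have "finite (range (\<lambda>n. (i + c * int n, j)))" using finite_poor finite_subset by blast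
  moreover have "inj (\<lambda>n. (i + c * int n, j))" using assms by (auto simp: inj_def)
  ultimately show False using finite_imageD by blast
qed

lemma run_poor: "m < run R \<Longrightarrow> (fst R - int m - 1, snd R) \<in> poor"
  unfolding run_def using not_less_Least by blast

lemma run_end: "(fst R - int (run R) - 1, snd R) \<notin> poor"
proof -
  obtain n where "(fst R - 1 + - 1 * int n, snd R) \<notin> poor" using poor_ray_ends by blast
  then have "(fst R - int n - 1, snd R) \<notin> poor" by (simp add: algebra_simps)
  then show ?thesis unfolding run_def by (rule LeastI)
qed

text \<open>The first block to the right of \<open>B\<close> that is not poor is active by
  \<open>right_of_poor_active\<close>, hence rich.\<close>

lemma poor_in_run:
  assumes "B \<in> poor"
  obtains R m where "R \<in> rich" "m < run R" "B = (fst R - int m - 1, snd R)"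
proof -
  obtain i j where B: "B = (i, j)" by (cases B)
  define n where "n = (LEAST n. (i + int n, j) \<notin> poor)"
  have "\<exists>n. (i + int n, j) \<notin> poor" using poor_ray_ends[of 1 i j] by auto
  then have n: "(i + int n, j) \<notin> poor" unfolding n_def by (rule LeastI_ex)
  have less: "(i + int m, j) \<in> poor" if "m < n" for m using that not_less_Least unfolding n_def by blast
  have "n \<noteq> 0" using n assms B by (intro notI) simp
  then obtain m where m: "n = Suc m" by (cases n) auto
  have "(i + int m + 1, j) \<in> active" using right_of_poor_active less[of m] m by simp
  then have R: "(i + int n, j) \<in> rich" using n unfolding poor_def m by (simp add: algebra_simps)
  \<comment> \<open>A shorter run would stop at a non-poor block between \<open>B\<close> and the
    rich block.\<close>
  have "m < run (i + int n, j)"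
  proof (rule ccontr)
    assume "\<not> ?thesis"
    then have "run (i + int n, j) \<le> m" by simp
    moreover have "(i + int (m - run (i + int n, j)), j) \<in> poor" by (rule less) (simp add: m)
    ultimately have "(i + int n - int (run (i + int n, j)) - 1, j) \<in> poor"
      by (simp add: m of_nat_diff add_diff_eq)
    then show False using run_end[of "(i + int n, j)"] by simp
  qed
  then show thesis using that[OF R] B m by simp
qed

text \<open>Runs are disjoint: if two of them shared a block, the rich block nearer to it would lie
  in the run of the other and be poor.\<close>

lemma sum_run: "(\<Sum>R\<in>rich. run R) \<le> card poor"
proof -
  define f where "f = (\<lambda>(R :: cell, m). (fst R - int m - 1, snd R))"
  have disj: False if "R \<in> rich" "R' \<in> rich" "m < run R" "m' < run R'" "m < m'" "f (R, m) = f (R', m')" for R R' m m'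
  proof -
    have "fst R = fst R' - int (m' - m - 1) - 1" "snd R = snd R'"
      using that(5,6) unfolding f_def by (auto simp: of_nat_diff)
    then have "R = (fst R' - int (m' - m - 1) - 1, snd R')" by (simp add: prod_eq_iff)
    then have "R \<in> poor" using run_poor[of "m' - m - 1" R'] that(4,5) by simp
    then show False using that(1) unfolding poor_def by blast
  qed
  have "inj_on f (SIGMA R:rich. {..<run R})"
  proof (rule inj_onI, clarsimp)
    fix i j m i' j' m'
    assume a: "(i, j) \<in> rich" "m < run (i, j)" "(i', j') \<in> rich" "m' < run (i', j')" "f ((i, j), m) = f ((i', j'), m')"
    then have "m = m'" using disj[of "(i, j)" "(i', j')" m m'] disj[of "(i', j')" "(i, j)" m' m] by (metis linorder_neqE_nat)
    then show "i = i' \<and> j = j' \<and> m = m'" using a(5) unfolding f_def by simp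
  qed
  moreover have "f ` (SIGMA R:rich. {..<run R}) \<subseteq> poor"
    unfolding f_def using run_poor by auto
  ultimately have "card (SIGMA R:rich. {..<run R}) \<le> card poor"
    using finite_poor card_inj_on_le by blast
  then show ?thesis using finite_rich by simp
qed

end

section \<open>Joining the loops\<close>

context spread_cells
begin

text \<open>Assigning blocks to loops transfers the connectedness of \<open>active\<close> to the
  loops.\<close>

definition loop_blocks :: "cell \<Rightarrow> cell set" where
  "loop_blocks R = insert R ((\<lambda>m. (fst R - int m - 1, snd R)) ` {..<run R})"

lemma loop_blocks_cover: "(\<Union>R\<in>rich. loop_blocks R) = active"
proof
  show "(\<Union>R\<in>rich. loop_blocks R) \<subseteq> active"
    using run_poor unfolding loop_blocks_def poor_def rich_def by auto
  show "active \<subseteq> (\<Union>R\<in>rich. loop_blocks R)"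
  proof
    fix B assume "B \<in> active"
    show "B \<in> (\<Union>R\<in>rich. loop_blocks R)"
    proof (cases "B \<in> rich")
      case True
      then show ?thesis unfolding loop_blocks_def by blast
    next
      case False
      then have "B \<in> poor" using \<open>B \<in> active\<close> unfolding poor_def by blast
      then obtain R m where "R \<in> rich" "m < run R" "B = (fst R - int m - 1, snd R)" by (rule poor_in_run)
      then show ?thesis unfolding loop_blocks_def by blast
    qed
  qed
qed

lemma rich_loop_block:
  assumes "R \<in> rich" "R \<in> loop_blocks R'"
  shows "R = R'"
  using assms run_poor unfolding loop_blocks_def poor_def by auto

lemma loop_near_block:
  assumes "R \<in> rich" "B \<in> loop_blocks R"
  obtains t where "t \<in> set (loop R (run R))" "\<bar>fst t - 72 * fst B\<bar> \<le> 144" "\<bar>snd t - 72 * snd B\<bar> \<le> 144"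
proof (cases "B = R")
  case True
  have "hub R \<noteq> []" using hub_nonempty assms unfolding rich_def by blast
  then obtain t where "t \<in> hub_tiles R" using hub(1)[of R] by (metis last_in_set)
  moreover from this have "\<bar>fst t - 72 * fst B\<bar> \<le> 144" "\<bar>snd t - 72 * snd B\<bar> \<le> 144"
    unfolding hub_tiles_def True by auto
  ultimately show thesis using that unfolding set_loop by blast
next
  case False
  then obtain m where m: "m < run R" "B = (fst R - int m - 1, snd R)"
    using assms unfolding loop_blocks_def by blast
  have "(72 * fst B, 72 * snd B) \<in> set (lower_stops B)" unfolding lower_stops_def by simp
  then have "(72 * fst B, 72 * snd B) \<in> set (loop R (run R))"
    using m unfolding set_loop by blast
  from that[OF this] show thesis by simp
qed

lemma tiles_meet_cells:
  assumes "t \<in> set (loop R (run R))"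
  shows "Q \<inter> tile g t \<noteq> {}"
proof (cases "t \<in> hub_tiles R")
  case True
  then show ?thesis unfolding hub_tiles_def by blast
next
  case False
  then obtain m where m: "m < run R" and
    t: "t \<in> set (lower_stops (fst R - int m - 1, snd R)) \<union> set (upper_stops (fst R - int m - 1, snd R))"
    using assms unfolding set_loop by blast
  define B where "B = (fst R - int m - 1, snd R)"
  have "fst t div 72 = fst B" "snd t div 72 = snd B"
    using stops_in_block[OF t] unfolding B_def[symmetric] by auto
  then have "tile g t \<subseteq> nbhd g 2 B"
    by (auto simp: nbhd_iff tile_iff block_of_tile)
  then show ?thesis using poor_tile run_poor[OF m] unfolding B_def by blast
qed

text \<open>A lattice stop near the cell belongs to an active block. If that block is poor, the stop
  is on a loop; if it is rich, the cell's own tile is in the hub.\<close>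

lemma cells_covered:
  assumes "q \<in> Q"
  shows "\<exists>R\<in>rich. \<exists>s\<in>set (loop R (run R)). cell_dist (tile_of q) s \<le> 24"
proof -
  obtain B s where s: "s \<in> set (lower_stops B) \<union> set (upper_stops B)" "cell_dist (tile_of q) s \<le> 24"
    using stops_cover_plane .
  have box: "72 * (fst B - 1) \<le> fst (tile_of q)" "fst (tile_of q) < 72 * (fst B + 2)"
    "72 * (snd B - 1) \<le> snd (tile_of q)" "snd (tile_of q) < 72 * (snd B + 2)"
    using s(2) stops_in_block[OF s(1)] unfolding cell_dist_def by auto
  then have "q \<in> nbhd g 1 B"
    using interval_div_iff[of 72 "fst (tile_of q)" "fst B - 1" "fst B + 2"]
      interval_div_iff[of 72 "snd (tile_of q)" "snd B - 1" "snd B + 2"]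
    unfolding nbhd_iff block_of_tile by auto
  then have "B \<in> active" using assms unfolding active_def by blast
  show ?thesis
  proof (cases "B \<in> rich")
    case True
    have "q \<in> Q \<inter> tile g (tile_of q)" using assms tile_iff by blast
    then have "tile_of q \<in> hub_tiles B" using box unfolding hub_tiles_def Int_iff mem_Times_iff by auto
    then have "tile_of q \<in> set (loop B (run B))" unfolding set_loop by blast
    moreover have "cell_dist (tile_of q) (tile_of q) \<le> 24" unfolding cell_dist_def by simp
    ultimately show ?thesis using True by blast
  next
    case False
    then have "B \<in> poor" using \<open>B \<in> active\<close> unfolding poor_def by blast
    then obtain R m where R: "R \<in> rich" "m < run R" "B = (fst R - int m - 1, snd R)" by (rule poor_in_run)
    then have "s \<in> set (loop R (run R))" using s(1) unfolding set_loop by blast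
    then show ?thesis using R(1) s(2) by blast
  qed
qed

lemma spread_tour:
  obtains S where "\<forall>t\<in>set S. Q \<inter> tile g t \<noteq> {}"
    "\<forall>q\<in>Q. \<exists>s\<in>set S. cell_dist (tile_of q) s \<le> 24"
    "length S \<le> 6 * card poor + 46656 * card rich"
    "walk_length cell_dist S \<le> 144 * int (card poor) + 20170000 * int (card rich)"
proof -
  have link: "\<exists>v\<in>X. \<exists>w\<in>rich - X. \<exists>a\<in>set (loop v (run v)). \<exists>b\<in>set (loop w (run w)). cell_dist a b \<le> 720"
    if X: "X \<subseteq> rich" "X \<noteq> {}" "X \<noteq> rich" for X
  proof -
    define U where "U = (\<Union>R\<in>X. loop_blocks R)"
    obtain R where "R \<in> X" using X by blast
    then have "R \<in> active \<inter> U" using X unfolding U_def loop_blocks_def rich_def by blast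
    then have 1: "active \<inter> U \<noteq> {}" by blast
    obtain R' where R': "R' \<in> rich" "R' \<notin> X" using X by blast
    then have "R' \<notin> U" using rich_loop_block unfolding U_def by blast
    then have 2: "\<not> active \<subseteq> U" using R' unfolding rich_def by blast
    obtain p q where pq: "p \<in> active \<inter> U" "q \<in> active - U" "king_adjacent p q"
      using king_connected_crossing[OF king_connected_active 1 2] .
    obtain v where v: "v \<in> X" "p \<in> loop_blocks v" using pq(1) unfolding U_def by blast
    obtain w where w: "w \<in> rich" "q \<in> loop_blocks w" using pq(2) loop_blocks_cover by blast
    have "w \<notin> X" using w pq(2) unfolding U_def by blast
    have "v \<in> rich" using v X by blast
    obtain a where a: "a \<in> set (loop v (run v))" "\<bar>fst a - 72 * fst p\<bar> \<le> 144" "\<bar>snd a - 72 * snd p\<bar> \<le> 144"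
      using loop_near_block[OF \<open>v \<in> rich\<close> v(2)] .
    obtain b where b: "b \<in> set (loop w (run w))" "\<bar>fst b - 72 * fst q\<bar> \<le> 144" "\<bar>snd b - 72 * snd q\<bar> \<le> 144"
      using loop_near_block[OF w] .
    \<comment> \<open>Four offsets of at most 144 tiles and a king step between blocks, at most 2 *
      72 tiles.\<close>
    have "cell_dist a b \<le> 720" using a(2,3) b(2,3) pq(3) unfolding cell_dist_def king_adjacent_def by linarith
    then show ?thesis using v(1) w(1) \<open>w \<notin> X\<close> a(1) b(1) by blast
  qed
  have "Q \<noteq> {}" using spread by blast
  then have "rich \<noteq> {}" using cells_covered by blast
  obtain S where S: "set S = (\<Union>R\<in>rich. set (loop R (run R)))" "length S = (\<Sum>R\<in>rich. length (loop R (run R)))"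
    "closed_length cell_dist S \<le> (\<Sum>R\<in>rich. closed_length cell_dist (loop R (run R)) + 2 * 720)"
    using cell.merge_connected_tours[where f = "\<lambda>R. loop R (run R)", OF finite_rich \<open>rich \<noteq> {}\<close> zero_le_numeral link] .
  have "length S \<le> (\<Sum>R\<in>rich. 46656 + 6 * run R)"
    unfolding S(2) length_loop by (rule sum_mono) (use hub(2) in auto)
  also have "\<dots> = 46656 * card rich + 6 * (\<Sum>R\<in>rich. run R)"
    by (simp add: sum.distrib sum_distrib_left)
  finally have len: "length S \<le> 6 * card poor + 46656 * card rich" using sum_run by simp
  have "walk_length cell_dist S \<le> closed_length cell_dist S" by (rule cell.walk_le_closed)
  also have "\<dots> \<le> (\<Sum>R\<in>rich. closed_length cell_dist (loop R (run R)) + 2 * 720)" by (rule S(3))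
  also have "\<dots> \<le> (\<Sum>R\<in>rich. 144 * int (run R) + 20170000)"
  proof (rule sum_mono)
    fix R assume "R \<in> rich"
    then show "closed_length cell_dist (loop R (run R)) + 2 * 720 \<le> 144 * int (run R) + 20170000"
      using loop_closed_length[of R "run R"] unfolding rich_def by auto
  qed
  also have "\<dots> = 144 * int (\<Sum>R\<in>rich. run R) + 20170000 * int (card rich)"
    by (simp add: sum.distrib sum_distrib_left)
  finally have walk: "walk_length cell_dist S \<le> 144 * int (card poor) + 20170000 * int (card rich)"
    using sum_run by linarith
  show thesis
    by (rule that[OF _ _ len walk]) (use S(1) tiles_meet_cells cells_covered in blast)+
qed

end

text \<open>The factor \<open>5183 * g\<^sup>2\<close> turns the number of poor blocks into cells
  via \<open>poor_area\<close>; 6 and 144 are the stops and the length per block. Rich blocks are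
  paid by the changes.\<close>

lemma tile_tour:
  assumes "finite Q" "king_connected Q" "0 < g"
  obtains S where "\<forall>t\<in>set S. Q \<inter> tile g t \<noteq> {}"
    "\<forall>q\<in>Q. \<exists>s\<in>set S. cell_dist (fst q div g, snd q div g) s \<le> 24"
    "5183 * g\<^sup>2 * int (length S) \<le> 6 * int (card Q)
       + 10 ^ 13 * (g * int (card (hor_changes Q) + card (ver_changes Q)) + g\<^sup>2)"
    "5183 * g\<^sup>2 * walk_length cell_dist S \<le> 144 * int (card Q)
       + 10 ^ 13 * (g * int (card (hor_changes Q) + card (ver_changes Q)) + g\<^sup>2)"
proof (cases "\<exists>B. Q \<subseteq> nbhd g 2 B")
  case False
  then interpret spread_cells Q g using assms by unfold_locales auto
  define n where "n = card (hor_changes Q) + card (ver_changes Q)"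
  obtain S where S: "\<forall>t\<in>set S. Q \<inter> tile g t \<noteq> {}"
    "\<forall>q\<in>Q. \<exists>s\<in>set S. cell_dist (tile_of q) s \<le> 24"
    "length S \<le> 6 * card poor + 46656 * card rich"
    "walk_length cell_dist S \<le> 144 * int (card poor) + 20170000 * int (card rich)"
    using spread_tour .
  have bound: "5183 * g\<^sup>2 * x \<le> c * int (card Q) + 10 ^ 13 * (g * int n + g\<^sup>2)"
    if "x \<le> c * int (card poor) + 20170000 * int (card rich)" "c \<ge> 0" for x c
  proof -
    have "5183 * g\<^sup>2 * x \<le> 5183 * g\<^sup>2 * (c * int (card poor) + 20170000 * int (card rich))"
      using that by (intro mult_left_mono) auto
    also have "\<dots> = c * (5183 * (g * g) * int (card poor)) + 5183 * 20170000 * g * (g * int (card rich))"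
      by (simp add: algebra_simps power2_eq_square)
    also have "\<dots> \<le> c * int (card Q) + 5183 * 20170000 * g * (25 * int n)"
      using card_poor card_rich that(2) g_pos unfolding n_def by (intro add_mono mult_left_mono) auto
    also have "\<dots> \<le> c * int (card Q) + 10 ^ 13 * (g * int n + g\<^sup>2)"
      using g_pos by (simp add: algebra_simps)
    finally show ?thesis .
  qed
  show thesis
  proof (rule that[of S])
    show "5183 * g\<^sup>2 * int (length S) \<le> 6 * int (card Q)
       + 10 ^ 13 * (g * int (card (hor_changes Q) + card (ver_changes Q)) + g\<^sup>2)"
      unfolding n_def[symmetric] by (rule bound) (use S(3) in auto)
    show "5183 * g\<^sup>2 * walk_length cell_dist S \<le> 144 * int (card Q)
       + 10 ^ 13 * (g * int (card (hor_changes Q) + card (ver_changes Q)) + g\<^sup>2)"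
      unfolding n_def[symmetric] by (rule bound) (use S(4) in auto)
  qed (use S(1,2) in \<open>auto simp: tile_of_def\<close>)
next
  case True
  then obtain B where B: "Q \<subseteq> nbhd g 2 B" by blast
  define V where "V = (\<lambda>q. (fst q div g, snd q div g)) ` Q"
  \<comment> \<open>At most (5 * 72)^2 = 129600 tiles are occupied, at mutual distance at most 2 *
    360. Visiting them in any order is paid by the term \<open>10 ^ 13 * g\<^sup>2\<close>.\<close>
  define M where "M = {72 * (fst B - 2)..<72 * (fst B + 3)} \<times> {72 * (snd B - 2)..<72 * (snd B + 3)}"
  have "V \<subseteq> M"
  proof
    fix t assume "t \<in> V"
    then obtain x y where q: "(x, y) \<in> Q" "t = (x div g, y div g)" unfolding V_def by auto
    then have "(x, y) \<in> nbhd g 2 B" using B by blast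
    then have "x \<in> {g * (72 * (fst B - 2))..<g * (72 * (fst B + 3))}" "y \<in> {g * (72 * (snd B - 2))..<g * (72 * (snd B + 3))}"
      unfolding nbhd_def by (auto simp: algebra_simps)
    then show "t \<in> M" unfolding q M_def interval_div_iff[OF assms(3)] by auto
  qed
  have "card M = 129600" unfolding M_def by (simp add: card_cartesian_product)
  then have "card V \<le> 129600" using \<open>V \<subseteq> M\<close> by (metis card_mono card.infinite zero_neq_numeral)
  obtain S where S: "set S = V" "distinct S"
    using finite_distinct_list[of V] assms(1) unfolding V_def by blast
  have len: "length S \<le> 129600" using \<open>card V \<le> 129600\<close> S distinct_card by metis
  have "cell_dist s t \<le> 720" if "s \<in> set S" "t \<in> set S" for s t
  proof -
    have "s \<in> M" "t \<in> M" using that S \<open>V \<subseteq> M\<close> by auto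
    then show ?thesis unfolding M_def cell_dist_def by auto
  qed
  from walk_length_bound[of S cell_dist, OF this] len
  have walk: "walk_length cell_dist S \<le> 720 * 129600" by simp
  have bound: "5183 * g\<^sup>2 * x \<le> c * int (card Q) + 10 ^ 13 * (g * int n + g\<^sup>2)"
    if "x \<le> 720 * 129600" "c \<ge> 0" for x c n
  proof -
    have "5183 * g\<^sup>2 * x \<le> 5183 * g\<^sup>2 * (720 * 129600)" using that by (intro mult_left_mono) auto
    also have "\<dots> \<le> 10 ^ 13 * g\<^sup>2" by simp
    also have "\<dots> \<le> c * int (card Q) + 10 ^ 13 * (g * int n + g\<^sup>2)" using that assms(3) by simp
    finally show ?thesis .
  qed
  show thesis
  proof (rule that[of S])
    show "\<forall>t\<in>set S. Q \<inter> tile g t \<noteq> {}"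
    proof
      fix t assume "t \<in> set S"
      then obtain x y where q: "(x, y) \<in> Q" "t = (x div g, y div g)" unfolding S V_def by auto
      then have "(x, y) \<in> tile g t"
        unfolding tile_def mem_Times_iff fst_conv snd_conv interval_div_iff[OF assms(3)] by auto
      then show "Q \<inter> tile g t \<noteq> {}" using q by blast
    qed
    have "cell_dist t t \<le> 24" for t unfolding cell_dist_def by simp
    then show "\<forall>q\<in>Q. \<exists>s\<in>set S. cell_dist (fst q div g, snd q div g) s \<le> 24"
      unfolding S V_def by blast
  qed (rule bound; use len walk in simp)+
qed

section \<open>From grids to cells\<close>

text \<open>Cells of side 1/m let a tile consist of an integral number of cells even when
  \<open>k\<close> is small.\<close>

definition refine :: "int \<Rightarrow> cell set \<Rightarrow> cell set" where
  "refine m Q = {q. (fst q div m, snd q div m) \<in> Q}"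

definition small_square :: "int \<Rightarrow> cell \<Rightarrow> (real \<times> real) set" where
  "small_square m c = {p. of_int (fst c) \<le> of_int m * fst p \<and> of_int m * fst p \<le> of_int (fst c) + 1
     \<and> of_int (snd c) \<le> of_int m * snd p \<and> of_int m * snd p \<le> of_int (snd c) + 1}"

lemma subdivide_unit_interval:
  fixes x :: real
  assumes "0 < m" "of_int a \<le> x" "x \<le> of_int a + 1"
  obtains i where "i div m = a" "of_int i \<le> of_int m * x" "of_int m * x \<le> of_int i + 1"
proof -
  \<comment> \<open>At the right end, where \<open>x = a + 1\<close>, the floor belongs to the next
    unit interval; the minimum selects the last piece of the present one.\<close>
  define i where "i = min \<lfloor>of_int m * x\<rfloor> (m * (a + 1) - 1)"
  have lo: "of_int m * of_int a \<le> of_int m * x" and hi: "of_int m * x \<le> of_int m * (of_int a + 1)"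
    using assms by (auto intro!: mult_left_mono)
  have "of_int (m * a) \<le> of_int m * x" using lo by simp
  then have "m * a \<le> i" using assms(1) unfolding i_def by (simp add: le_floor_iff algebra_simps)
  moreover have "i < m * (a + 1)" unfolding i_def by simp
  ultimately have "i \<in> {m * a..<m * (a + 1)}" by simp
  then have "i div m = a" unfolding interval_div_iff[OF assms(1)] by simp
  moreover have "of_int i \<le> of_int m * x" unfolding i_def by linarith
  moreover have "of_int m * x \<le> of_int i + 1" using hi unfolding i_def by (auto simp: min_def)
  ultimately show thesis using that by blast
qed

lemma subdivided_interval_subset:
  fixes x :: real
  assumes "0 < m" "i div m = a" "of_int i \<le> of_int m * x" "of_int m * x \<le> of_int i + 1"
  shows "of_int a \<le> x" "x \<le> of_int a + 1"
proof -
  have "i \<in> {m * a..<m * (a + 1)}" unfolding interval_div_iff[OF assms(1)] using assms(2) by simp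
  then have "real_of_int (m * a) \<le> of_int i" "real_of_int (i + 1) \<le> of_int (m * (a + 1))"
    by (simp_all only: of_int_le_iff) auto
  then have "of_int m * of_int a \<le> of_int m * x" "of_int m * x \<le> of_int m * (of_int a + 1)"
    using assms(3,4) by simp_all
  then show "of_int a \<le> x" "x \<le> of_int a + 1" using assms(1) by simp_all
qed

lemma Union_small_squares:
  assumes "0 < m"
  shows "(\<Union>c\<in>refine m Q. small_square m c) = (\<Union>c\<in>Q. unit_square c)"
proof
  show "(\<Union>c\<in>refine m Q. small_square m c) \<subseteq> (\<Union>c\<in>Q. unit_square c)"
  proof
    fix p assume "p \<in> (\<Union>c\<in>refine m Q. small_square m c)"
    then obtain i j where c: "(i div m, j div m) \<in> Q"
      "of_int i \<le> of_int m * fst p" "of_int m * fst p \<le> of_int i + 1"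
      "of_int j \<le> of_int m * snd p" "of_int m * snd p \<le> of_int j + 1"
      unfolding refine_def small_square_def by auto
    then have "p \<in> unit_square (i div m, j div m)"
      using subdivided_interval_subset[OF assms refl, of i "fst p"]
        subdivided_interval_subset[OF assms refl, of j "snd p"]
      unfolding unit_square_def mem_Times_iff by auto
    then show "p \<in> (\<Union>c\<in>Q. unit_square c)" using c(1) by blast
  qed
  show "(\<Union>c\<in>Q. unit_square c) \<subseteq> (\<Union>c\<in>refine m Q. small_square m c)"
  proof
    fix p assume "p \<in> (\<Union>c\<in>Q. unit_square c)"
    then obtain a b where ab: "(a, b) \<in> Q" "of_int a \<le> fst p" "fst p \<le> of_int a + 1"
      "of_int b \<le> snd p" "snd p \<le> of_int b + 1"
      unfolding unit_square_def by auto
    obtain i where i: "i div m = a" "of_int i \<le> of_int m * fst p" "of_int m * fst p \<le> of_int i + 1"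
      using subdivide_unit_interval[OF assms ab(2,3)] .
    obtain j where j: "j div m = b" "of_int j \<le> of_int m * snd p" "of_int m * snd p \<le> of_int j + 1"
      using subdivide_unit_interval[OF assms ab(4,5)] .
    have "(i, j) \<in> refine m Q" "p \<in> small_square m (i, j)"
      using i j ab(1) unfolding refine_def small_square_def by auto
    then show "p \<in> (\<Union>c\<in>refine m Q. small_square m c)" by blast
  qed
qed

lemma closed_small_square: "closed (small_square m c)"
  unfolding small_square_def by (intro closed_Collect_conj closed_Collect_le continuous_intros)

section \<open>Cell and change counts under refinement\<close>

lemma refine_in_image:
  assumes "0 < m"
  shows "refine m Q \<subseteq> (\<lambda>((a, b), r, s). (m * a + r, m * b + s)) ` (Q \<times> {0..<m} \<times> {0..<m})"
proof
  fix q assume "q \<in> refine m Q"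
  then have "((fst q div m, snd q div m), fst q mod m, snd q mod m) \<in> Q \<times> {0..<m} \<times> {0..<m}"
    using assms unfolding refine_def by auto
  then show "q \<in> (\<lambda>((a, b), r, s). (m * a + r, m * b + s)) ` (Q \<times> {0..<m} \<times> {0..<m})"
    by (rule rev_image_eqI) simp
qed

lemma finite_refine: "0 < m \<Longrightarrow> finite Q \<Longrightarrow> finite (refine m Q)"
  using finite_subset[OF refine_in_image] by blast

lemma card_refine:
  assumes "0 < m" "finite Q"
  shows "int (card (refine m Q)) \<le> m\<^sup>2 * int (card Q)"
proof -
  have "card (refine m Q) \<le> card (Q \<times> {0..<m} \<times> {0..<m})"
    using assms by (intro surj_card_le[OF _ refine_in_image]) auto
  also have "\<dots> = card Q * (nat m * nat m)" by (simp add: card_cartesian_product)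
  finally have "int (card (refine m Q)) \<le> int (card Q * (nat m * nat m))" by (simp only: of_nat_le_iff)
  then show ?thesis using assms by (simp add: power2_eq_square mult.commute)
qed

lemma div_succ_change:
  fixes i m :: int
  assumes "0 < m" "(i + 1) div m \<noteq> i div m"
  shows "(i + 1) div m = i div m + 1" "i = m * (i div m) + m - 1"
proof -
  define q where "q = i div m"
  have q: "m * q \<le> i" "i < m * (q + 1)"
    using interval_div_iff[OF assms(1), of i q "q + 1"] unfolding q_def by auto
  have "\<not> i + 1 < m * (q + 1)"
    using interval_div_iff[OF assms(1), of "i + 1" q "q + 1"] assms(2) q unfolding q_def[symmetric] by auto
  then have i: "i = m * q + m - 1" using q by (simp add: algebra_simps)
  then show "i = m * (i div m) + m - 1" unfolding q_def .
  have "i + 1 = m * (q + 1)" using i by (simp add: algebra_simps)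
  then have "(i + 1) div m = q + 1" using assms(1) by simp
  then show "(i + 1) div m = i div m + 1" unfolding q_def .
qed

text \<open>Cells of one unit square share its colour, so changes occur only across unit edges. Each
  of these is cut into \<open>m\<close> pieces, indexed by the remainder along the edge.\<close>

lemma card_changes_refine:
  assumes "0 < m" "finite Q"
  shows "int (card (hor_changes (refine m Q))) \<le> m * int (card (hor_changes Q))"
    "int (card (ver_changes (refine m Q))) \<le> m * int (card (ver_changes Q))"
proof -
  have "hor_changes (refine m Q) \<subseteq> (\<lambda>((a, b), s). (m * a + m - 1, m * b + s)) ` (hor_changes Q \<times> {0..<m})"
  proof
    fix q assume q: "q \<in> hor_changes (refine m Q)"
    obtain i j where ij: "q = (i, j)" by (cases q)
    have ne: "((i div m, j div m) \<in> Q) \<noteq> (((i + 1) div m, j div m) \<in> Q)"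
      using q unfolding ij hor_changes_def refine_def by auto
    then have "(i + 1) div m \<noteq> i div m" by metis
    note d = div_succ_change[OF assms(1) this]
    have "((i div m, j div m), j mod m) \<in> hor_changes Q \<times> {0..<m}"
      using ne assms(1) unfolding hor_changes_def d(1) by auto
    then show "q \<in> (\<lambda>((a, b), s). (m * a + m - 1, m * b + s)) ` (hor_changes Q \<times> {0..<m})"
      by (rule rev_image_eqI) (use d(2) ij in simp)
  qed
  then have "card (hor_changes (refine m Q)) \<le> card (hor_changes Q \<times> {0..<m})"
    by (rule surj_card_le[rotated]) (simp add: finite_changes[OF assms(2)])
  then have "int (card (hor_changes (refine m Q))) \<le> int (card (hor_changes Q) * nat m)"
    by (simp only: of_nat_le_iff) (simp add: card_cartesian_product)
  then show "int (card (hor_changes (refine m Q))) \<le> m * int (card (hor_changes Q))"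
    using assms(1) by (simp add: mult.commute)
  have "ver_changes (refine m Q) \<subseteq> (\<lambda>((a, b), s). (m * a + s, m * b + m - 1)) ` (ver_changes Q \<times> {0..<m})"
  proof
    fix q assume q: "q \<in> ver_changes (refine m Q)"
    obtain i j where ij: "q = (i, j)" by (cases q)
    have ne: "((i div m, j div m) \<in> Q) \<noteq> ((i div m, (j + 1) div m) \<in> Q)"
      using q unfolding ij ver_changes_def refine_def by auto
    then have "(j + 1) div m \<noteq> j div m" by metis
    note d = div_succ_change[OF assms(1) this]
    have "((i div m, j div m), i mod m) \<in> ver_changes Q \<times> {0..<m}"
      using ne assms(1) unfolding ver_changes_def d(1) by auto
    then show "q \<in> (\<lambda>((a, b), s). (m * a + s, m * b + m - 1)) ` (ver_changes Q \<times> {0..<m})"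
      by (rule rev_image_eqI) (use d(2) ij in simp)
  qed
  then have "card (ver_changes (refine m Q)) \<le> card (ver_changes Q \<times> {0..<m})"
    by (rule surj_card_le[rotated]) (simp add: finite_changes[OF assms(2)])
  then have "int (card (ver_changes (refine m Q))) \<le> int (card (ver_changes Q) * nat m)"
    by (simp only: of_nat_le_iff) (simp add: card_cartesian_product)
  then show "int (card (ver_changes (refine m Q))) \<le> m * int (card (ver_changes Q))"
    using assms(1) by (simp add: mult.commute)
qed

text \<open>A cut of the cells splits the grid into two nonempty closed sets. By connectedness they
  share a point, and two small squares through a common point are king adjacent.\<close>

lemma king_connected_refine:
  assumes "0 < m" "finite Q" "connected (\<Union>c\<in>Q. unit_square c)"
  shows "king_connected (refine m Q)"
  unfolding king_connected_def
proof (intro allI impI)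
  fix X assume X: "X \<subseteq> refine m Q" "X \<noteq> {}" "X \<noteq> refine m Q"
  define A where "A = (\<Union>c\<in>X. small_square m c)"
  define B where "B = (\<Union>c\<in>refine m Q - X. small_square m c)"
  have fin: "finite (refine m Q)" using finite_refine assms by blast
  then have "closed A" "closed B" unfolding A_def B_def
    using closed_small_square finite_subset[OF X(1)] by (auto intro!: closed_UN)
  have un: "(\<Union>c\<in>Q. unit_square c) = A \<union> B"
    unfolding A_def B_def Union_small_squares[OF assms(1), symmetric] using X by blast
  have ne: "small_square m c \<noteq> {}" for c
  proof -
    have "(of_int (fst c) / of_int m, of_int (snd c) / of_int m) \<in> small_square m c"
      using assms(1) unfolding small_square_def by simp
    then show ?thesis by blast
  qed
  have "A \<noteq> {}" "B \<noteq> {}" unfolding A_def B_def using ne X by auto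
  then have "A \<inter> B \<noteq> {}"
    using assms(3) \<open>closed A\<close> \<open>closed B\<close> unfolding un connected_closed by blast
  then obtain p c d where c: "c \<in> X" "p \<in> small_square m c" and d: "d \<in> refine m Q - X" "p \<in> small_square m d"
    unfolding A_def B_def by blast
  have "real_of_int (fst c) \<le> of_int (fst d + 1)" "real_of_int (fst d) \<le> of_int (fst c + 1)"
    "real_of_int (snd c) \<le> of_int (snd d + 1)" "real_of_int (snd d) \<le> of_int (snd c + 1)"
    using c d unfolding small_square_def by auto
  then have "king_adjacent c d" unfolding king_adjacent_def of_int_le_iff by auto
  then show "\<exists>p\<in>X. \<exists>q\<in>refine m Q - X. king_adjacent p q" using c d by blast
qed

text \<open>Each change is sent to the edge between its two cells, which lies in the frontier
  because just one of them belongs to \<open>Q\<close>.\<close>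

lemma card_changes_le_perimeter:
  assumes "finite Q" "G = (\<Union>c\<in>Q. unit_square c)"
  shows "real (card (hor_changes Q) + card (ver_changes Q)) \<le> perimeter G"
proof -
  define e where "e = (\<lambda>(i, j). ver_edge (i + 1) j)"
  define f where "f = (\<lambda>(i, j). hor_edge i (j + 1))"
  have inje: "inj e" and injf: "inj f"
    unfolding e_def f_def inj_def ver_edge_def hor_edge_def by (auto simp: times_eq_iff)
  have disj: "e ` A \<inter> f ` B = {}" for A B
    unfolding e_def f_def ver_edge_def hor_edge_def by (auto simp: times_eq_iff)
  have fr: "x \<subseteq> frontier G" if "(c \<in> Q) \<noteq> (d \<in> Q)" "x \<subseteq> unit_square c" "x \<subseteq> unit_square d" for c d x
    using that squares_Int_subset_frontier[OF assms(2), of c d x] squares_Int_subset_frontier[OF assms(2), of d c x] by blast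
  have "e ` hor_changes Q \<subseteq> boundary_edges G"
  proof
    fix x assume "x \<in> e ` hor_changes Q"
    then obtain i j where ij: "x = ver_edge (i + 1) j" "((i, j) \<in> Q) \<noteq> ((i + 1, j) \<in> Q)"
      unfolding e_def hor_changes_def by auto
    have "x \<subseteq> unit_square (i, j)" "x \<subseteq> unit_square (i + 1, j)"
      unfolding ij ver_edge_def unit_square_def by auto
    then show "x \<in> boundary_edges G" using fr[OF ij(2)] ij(1) unfolding boundary_edges_def by blast
  qed
  moreover have "f ` ver_changes Q \<subseteq> boundary_edges G"
  proof
    fix x assume "x \<in> f ` ver_changes Q"
    then obtain i j where ij: "x = hor_edge i (j + 1)" "((i, j) \<in> Q) \<noteq> ((i, j + 1) \<in> Q)"
      unfolding f_def ver_changes_def by auto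
    have "x \<subseteq> unit_square (i, j)" "x \<subseteq> unit_square (i, j + 1)"
      unfolding ij hor_edge_def unit_square_def by auto
    then show "x \<in> boundary_edges G" using fr[OF ij(2)] ij(1) unfolding boundary_edges_def by blast
  qed
  moreover have "finite (boundary_edges G)"
    using assms finite_boundary_edges unfolding is_grid_def by blast
  ultimately have "card (e ` hor_changes Q \<union> f ` ver_changes Q) \<le> card (boundary_edges G)"
    by (intro card_mono) auto
  moreover have "card (e ` hor_changes Q \<union> f ` ver_changes Q) = card (hor_changes Q) + card (ver_changes Q)"
    using finite_changes[OF assms(1)] disj inje injf
    by (subst card_Un_disjoint) (auto simp: card_image inj_on_subset)
  ultimately show ?thesis unfolding perimeter_def by simp
qed

text \<open>Distinct unit squares meet in a convex set with empty interior, which is negligible, so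
  areas add up.\<close>

lemma card_le_grid_area:
  assumes "finite Q" "G = (\<Union>c\<in>Q. unit_square c)"
  shows "real (card Q) \<le> grid_area G"
proof -
  have sq: "unit_square c = cbox (of_int (fst c), of_int (snd c)) (of_int (fst c) + 1, of_int (snd c) + 1)" for c
    unfolding unit_square_def by (simp add: cbox_Pair_eq)
  have int: "interior (unit_square c) = box (of_int (fst c), of_int (snd c)) (of_int (fst c) + 1, of_int (snd c) + 1)" for c
    unfolding sq by (rule interior_cbox)
  have "negligible (unit_square c \<inter> unit_square d)" if "c \<noteq> d" for c d
  proof -
    have "interior (unit_square c \<inter> unit_square d) = {}"
    proof (rule ccontr)
      assume "interior (unit_square c \<inter> unit_square d) \<noteq> {}"
      then obtain x y where "(x, y) \<in> interior (unit_square c)" "(x, y) \<in> interior (unit_square d)"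
        unfolding interior_Int by auto
      then have "real_of_int (fst c) < of_int (fst d + 1)" "real_of_int (fst d) < of_int (fst c + 1)"
        "real_of_int (snd c) < of_int (snd d + 1)" "real_of_int (snd d) < of_int (snd c + 1)"
        unfolding int by (auto simp: box_def Basis_prod_def)
      then have "fst c = fst d" "snd c = snd d" unfolding of_int_less_iff by auto
      then show False using that by (simp add: prod_eq_iff)
    qed
    moreover have "convex (unit_square c \<inter> unit_square d)" unfolding sq by (intro convex_Int convex_box)
    ultimately show ?thesis using negligible_convex_interior by blast
  qed
  then have "measure lebesgue (\<Union>(unit_square ` Q)) = (\<Sum>c\<in>Q. measure lebesgue (unit_square c))"
    by (intro measure_negligible_finite_Union_image)
      (auto simp: assms(1) pairwise_def sq)
  moreover have "measure lebesgue (unit_square c) = 1" for c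
  proof -
    have "unit_square c \<noteq> {}" unfolding unit_square_def by simp
    then show ?thesis unfolding sq by (simp add: content_cbox_if Basis_prod_def)
  qed
  ultimately show ?thesis unfolding grid_area_def assms(2) by simp
qed

text \<open>In terms of \<open>D\<close> and \<open>r\<close>, doubling sigma multiplies
  \<open>\<alpha> / k\<close> by (D + r) / D and \<open>\<beta> / k\<^sup>2\<close> by (D + r)^2 /
  (4 D r). Both factors are at least 1, the second by the inequality of arithmetic and geometric
  means.\<close>

lemma sigma_param_lower_bound:
  assumes "0 < \<alpha>" "0 < \<beta>" "0 < k"
  shows "\<alpha> / k + \<beta> / k\<^sup>2 \<le> 2 * sigma_param \<alpha> \<beta> k"
proof -
  define D where "D = 4 * \<alpha> * k + \<beta>"
  define r where "r = sqrt (D * \<beta>)"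
  have D: "D > 0" unfolding D_def using assms by (simp add: add_pos_pos)
  have r: "r > 0" unfolding r_def using D assms by simp
  have gamma: "gamma_param \<alpha> \<beta> k = (D + r) / (2 * k * D)"
    unfolding gamma_param_def r_def D_def ..
  have den: "4 * k * ((D + r) / (2 * k * D)) - 2 = 2 * r / D"
    using assms D by (simp add: field_simps)
  have "2 * sigma_param \<alpha> \<beta> k = \<alpha> / k * ((D + r) / D) + \<beta> / k\<^sup>2 * ((D + r)\<^sup>2 / (4 * D * r))"
    unfolding sigma_param_def gamma den using assms D r by (simp add: field_simps power2_eq_square)
  moreover have "\<alpha> / k * 1 \<le> \<alpha> / k * ((D + r) / D)"
    using assms D r by (intro mult_left_mono) (auto simp: field_simps)
  moreover have "\<beta> / k\<^sup>2 * 1 \<le> \<beta> / k\<^sup>2 * ((D + r)\<^sup>2 / (4 * D * r))"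
  proof (intro mult_left_mono)
    have "0 \<le> (D - r)\<^sup>2" by simp
    then show "1 \<le> (D + r)\<^sup>2 / (4 * D * r)" using D r by (simp add: field_simps power2_eq_square)
  qed (use assms in simp)
  ultimately show ?thesis by simp
qed

lemma l1_dist_commute: "l1_dist p q = l1_dist q p"
  unfolding l1_dist_def by (simp add: abs_minus_commute)

lemma path_length_eq_walk_length: "path_length S = walk_length l1_dist S"
  unfolding path_length_def
proof (induction "l1_dist" S rule: walk_length.induct)
  case (1 x y xs)
  have "(\<Sum>i<length (x # y # xs) - 1. l1_dist ((x # y # xs) ! Suc i) ((x # y # xs) ! i))
      = l1_dist y x + (\<Sum>i<length (y # xs) - 1. l1_dist ((y # xs) ! Suc i) ((y # xs) ! i))"
    by (simp add: sum.lessThan_Suc_shift del: sum.lessThan_Suc)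
  then show ?case using 1 l1_dist_commute[of x y] by simp
qed auto

section \<open>Covering paths\<close>

lemma interval_dist_bound:
  fixes x y :: real
  assumes "0 < g" "of_int (g * a) \<le> x" "x \<le> of_int (g * (a + 1))"
    "of_int (g * b) \<le> y" "y \<le> of_int (g * (b + 1))"
  shows "\<bar>x - y\<bar> \<le> of_int g * (of_int \<bar>a - b\<bar> + 1)"
proof -
  have "of_int g * (of_int a - of_int b) \<le> of_int g * (of_int \<bar>a - b\<bar> :: real)"
    "of_int g * (of_int b - of_int a) \<le> of_int g * (of_int \<bar>a - b\<bar> :: real)"
    using assms(1) by (intro mult_left_mono; simp)+
  then show ?thesis using assms unfolding abs_le_iff by (auto simp: algebra_simps)
qed

text \<open>The 2 per leg allows the ends to lie anywhere in their tiles, one tile side per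
  coordinate.\<close>

lemma walk_length_map_le:
  fixes d :: "'a \<Rightarrow> 'a \<Rightarrow> int" and e :: "'b \<Rightarrow> 'b \<Rightarrow> real"
  assumes "\<And>s t. s \<in> set S \<Longrightarrow> t \<in> set S \<Longrightarrow> e (f s) (f t) \<le> c * (of_int (d s t) + 2)" "0 \<le> c"
  shows "walk_length e (map f S) \<le> c * (of_int (walk_length d S) + 2 * real (length S))"
  using assms
proof (induction d S rule: walk_length.induct)
  case (1 d x y xs)
  have "walk_length e (map f (y # xs)) \<le> c * (of_int (walk_length d (y # xs)) + 2 * real (length (y # xs)))"
    using 1 by simp
  moreover have "e (f x) (f y) \<le> c * (of_int (d x y) + 2)" using 1(2) by simp
  ultimately show ?case by (simp add: algebra_simps)
qed auto

lemma covering_path_exists: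
  assumes "0 < k" and G: "is_grid G" "connected G"
  obtains S where "covering_path G k S"
    "path_length S * k \<le> grid_area G + 10 ^ 13 * k * perimeter G + 10 ^ 13 * k\<^sup>2"
    "real (stop_count S) * k\<^sup>2 \<le> grid_area G + 10 ^ 13 * k * perimeter G + 10 ^ 13 * k\<^sup>2"
proof -
  obtain Q where Q: "finite Q" "G = (\<Union>c\<in>Q. unit_square c)" using G(1) unfolding is_grid_def by blast
  \<comment> \<open>The subdivision is so fine that the radius \<open>K\<close>, measured in cells,
    is at least 260.\<close>
  define m where "m = max 1 \<lceil>260 / k\<rceil>"
  define K where "K = k * of_int m"
  \<comment> \<open>Covering within 24 tiles between indices means 24 + 2 = 26 tile sides between
    points, which must not exceed \<open>K\<close>.\<close>
  define g where "g = \<lfloor>K / 26\<rfloor>"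
  have m: "0 < m" "1 \<le> m" unfolding m_def by auto
  have "260 / k \<le> of_int m" unfolding m_def by linarith
  then have K: "260 \<le> K" using assms(1) unfolding K_def by (simp add: field_simps)
  have "10 \<le> g" unfolding g_def le_floor_iff using K by simp
  then have g: "0 < g" "10 \<le> real_of_int g" by simp_all
  have gK: "26 * of_int g \<le> K" "K \<le> 26 * (of_int g + 1)" 
    using floor_correct[of "K / 26"] unfolding g_def by (auto simp: field_simps)
  \<comment> \<open>Since \<open>g\<close> is at least 10, \<open>g + 1\<close> is at most 1.1 times
    \<open>g\<close>, and 28.6 = 26 * 1.1.\<close>
  have Kg: "K \<le> 28.6 * of_int g" using gK(2) g(2) by simp
  define q where "q = refine m Q"
  have q: "finite q" "king_connected q"
    unfolding q_def using finite_refine[OF m(1) Q(1)] king_connected_refine[OF m(1) Q(1)] G(2) Q(2) by auto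
  obtain S where S: "\<forall>t\<in>set S. q \<inter> tile g t \<noteq> {}"
    "\<forall>c\<in>q. \<exists>s\<in>set S. cell_dist (fst c div g, snd c div g) s \<le> 24"
    "5183 * g\<^sup>2 * int (length S) \<le> 6 * int (card q)
       + 10 ^ 13 * (g * int (card (hor_changes q) + card (ver_changes q)) + g\<^sup>2)"
    "5183 * g\<^sup>2 * walk_length cell_dist S \<le> 144 * int (card q)
       + 10 ^ 13 * (g * int (card (hor_changes q) + card (ver_changes q)) + g\<^sup>2)"
    using tile_tour[OF q g(1)] .
  define rep where "rep t = (SOME c. c \<in> q \<inter> tile g t)" for t
  have rep: "rep t \<in> q" "rep t \<in> tile g t" if "t \<in> set S" for t
  proof -
    have "\<exists>c. c \<in> q \<inter> tile g t" using S(1) that by blast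
    then have "rep t \<in> q \<inter> tile g t" unfolding rep_def by (rule someI_ex)
    then show "rep t \<in> q" "rep t \<in> tile g t" by auto
  qed
  define stop where "stop t = (of_int (fst (rep t)) / of_int m :: real, of_int (snd (rep t)) / of_int m :: real)" for t
  have near: "l1_dist p p' \<le> of_int g / of_int m * (of_int (cell_dist t t') + 2)"
    if c: "p \<in> small_square m c" "c \<in> tile g t" "p' \<in> small_square m c'" "c' \<in> tile g t'" for p p' c c' t t'
  proof -
    have box: "of_int (g * a) \<le> x" "x \<le> of_int (g * (a + 1))"
      if "i \<in> {g * a..<g * (a + 1)}" "of_int i \<le> x" "x \<le> of_int i + 1" for i a and x :: real
    proof -
      have "real_of_int (g * a) \<le> of_int i" "real_of_int (i + 1) \<le> of_int (g * (a + 1))"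
        using that(1) unfolding of_int_le_iff by auto
      then show "of_int (g * a) \<le> x" "x \<le> of_int (g * (a + 1))" using that(2,3) by simp_all
    qed
    have x: "of_int (g * fst t) \<le> of_int m * fst p" "of_int m * fst p \<le> of_int (g * (fst t + 1))"
      "of_int (g * snd t) \<le> of_int m * snd p" "of_int m * snd p \<le> of_int (g * (snd t + 1))"
      by (rule box[of "fst c"] box[of "snd c"]; use c(1,2) in \<open>auto simp: small_square_def tile_def\<close>)+
    have y: "of_int (g * fst t') \<le> of_int m * fst p'" "of_int m * fst p' \<le> of_int (g * (fst t' + 1))"
      "of_int (g * snd t') \<le> of_int m * snd p'" "of_int m * snd p' \<le> of_int (g * (snd t' + 1))"
      by (rule box[of "fst c'"] box[of "snd c'"]; use c(3,4) in \<open>auto simp: small_square_def tile_def\<close>)+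
    have "\<bar>of_int m * fst p - of_int m * fst p'\<bar> + \<bar>of_int m * snd p - of_int m * snd p'\<bar>
        \<le> of_int g * (of_int \<bar>fst t - fst t'\<bar> + 1) + of_int g * (of_int \<bar>snd t - snd t'\<bar> + 1)"
      using x y g(1) by (intro add_mono interval_dist_bound) auto
    also have "\<dots> = of_int g * (of_int (cell_dist t t') + 2)"
      unfolding cell_dist_def by (simp add: algebra_simps)
    finally have "of_int m * l1_dist p p' \<le> of_int g * (of_int (cell_dist t t') + 2)"
      using m(1) unfolding l1_dist_def by (simp add: right_diff_distrib[symmetric] abs_mult distrib_left)
    then show ?thesis using m(1) by (simp add: field_simps)
  qed
  have stop: "stop t \<in> small_square m (rep t)" for t
    using m(1) unfolding stop_def small_square_def by simp
  have GU: "G = (\<Union>c\<in>q. small_square m c)" unfolding q_def Union_small_squares[OF m(1)] by (rule Q(2))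
  have cov: "covering_path G k (map stop S)"
    unfolding covering_path_def
  proof (intro conjI ballI)
    show "set (map stop S) \<subseteq> G" using stop rep(1) unfolding GU set_map by blast
    fix p assume "p \<in> G"
    then obtain c where c: "c \<in> q" "p \<in> small_square m c" unfolding GU by blast
    then obtain s where s: "s \<in> set S" "cell_dist (fst c div g, snd c div g) s \<le> 24" using S(2) by blast
    have "c \<in> tile g (fst c div g, snd c div g)"
      unfolding tile_def mem_Times_iff fst_conv snd_conv interval_div_iff[OF g(1)] by auto
    from near[OF c(2) this stop rep(2)[OF s(1)]]
    have "l1_dist p (stop s) \<le> of_int g / of_int m * (of_int (cell_dist (fst c div g, snd c div g) s) + 2)" .
    also have "\<dots> \<le> of_int g / of_int m * 26" using s(2) g(1) m(1) by (intro mult_left_mono) auto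
    also have "\<dots> \<le> k" using gK(1) m(1) unfolding K_def by (simp add: field_simps)
    finally show "\<exists>s\<in>set (map stop S). l1_dist p s \<le> k" using s(1) by auto
  qed
  define A P T l where "A = grid_area G" and "P = perimeter G" and "T = real (length S)"
    and "l = real_of_int (walk_length cell_dist S)"
  \<comment> \<open>\<open>6 * E\<close> and \<open>144 * E\<close> dominate the two bounds of
    \<open>tile_tour\<close>.\<close>
  define E where "E = real (card q) + 10 ^ 13 * (of_int g * real (card (hor_changes q) + card (ver_changes q)) + (of_int g)\<^sup>2)"
  have "real (card q) \<le> (of_int m)\<^sup>2 * A"
  proof -
    have "real (card q) \<le> of_int (m\<^sup>2 * int (card Q))"
      using card_refine[OF m(1) Q(1)] unfolding q_def by (metis of_int_le_iff of_int_of_nat_eq)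
    also have "\<dots> = (of_int m)\<^sup>2 * real (card Q)" by simp
    also have "\<dots> \<le> (of_int m)\<^sup>2 * A"
      using card_le_grid_area[OF Q] unfolding A_def by (intro mult_left_mono) auto
    finally show ?thesis .
  qed
  moreover have "real (card (hor_changes q) + card (ver_changes q)) \<le> of_int m * P"
  proof -
    have "int (card (hor_changes q) + card (ver_changes q)) \<le> m * int (card (hor_changes Q) + card (ver_changes Q))"
      using card_changes_refine[OF m(1) Q(1)] unfolding q_def by (simp add: distrib_left)
    then have "real (card (hor_changes q) + card (ver_changes q)) \<le> of_int (m * int (card (hor_changes Q) + card (ver_changes Q)))"
      by (metis of_int_le_iff of_int_of_nat_eq)
    also have "\<dots> = of_int m * real (card (hor_changes Q) + card (ver_changes Q))" by simp
    also have "\<dots> \<le> of_int m * P"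
      using card_changes_le_perimeter[OF Q] m(1) unfolding P_def by (intro mult_left_mono) auto
    finally show ?thesis .
  qed
  moreover have "of_int g \<le> K" using gK(1) g by linarith
  ultimately have "E \<le> (of_int m)\<^sup>2 * A + 10 ^ 13 * (K * (of_int m * P) + K\<^sup>2)"
    unfolding E_def using g K by (intro add_mono mult_left_mono mult_mono power_mono) auto
  also have "\<dots> = (of_int m)\<^sup>2 * (A + 10 ^ 13 * k * P + 10 ^ 13 * k\<^sup>2)"
    unfolding K_def by (simp add: algebra_simps power2_eq_square)
  finally have E: "E \<le> (of_int m)\<^sup>2 * (A + 10 ^ 13 * k * P + 10 ^ 13 * k\<^sup>2)" .
  have E1: "6 * real (card q) + 10 ^ 13 * (of_int g * real (card (hor_changes q) + card (ver_changes q)) + (of_int g)\<^sup>2) \<le> 6 * E"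
    "144 * real (card q) + 10 ^ 13 * (of_int g * real (card (hor_changes q) + card (ver_changes q)) + (of_int g)\<^sup>2) \<le> 144 * E"
    unfolding E_def using g by simp_all
  have "real_of_int (5183 * g\<^sup>2 * int (length S)) \<le> of_int (6 * int (card q)
       + 10 ^ 13 * (g * int (card (hor_changes q) + card (ver_changes q)) + g\<^sup>2))"
    using S(3) unfolding of_int_le_iff .
  then have T: "5183 * ((of_int g)\<^sup>2 * T) \<le> 6 * E"
    using E1(1) unfolding T_def by (simp add: mult.assoc)
  have "real_of_int (5183 * g\<^sup>2 * walk_length cell_dist S) \<le> of_int (144 * int (card q)
       + 10 ^ 13 * (g * int (card (hor_changes q) + card (ver_changes q)) + g\<^sup>2))"
    using S(4) unfolding of_int_le_iff .
  then have l: "5183 * ((of_int g)\<^sup>2 * l) \<le> 144 * E"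
    using E1(2) unfolding l_def by (simp add: mult.assoc)
  have "0 \<le> E" unfolding E_def using g by simp
  have "(of_int m)\<^sup>2 * (T * k\<^sup>2) = K\<^sup>2 * T" unfolding K_def by (simp add: algebra_simps power2_eq_square)
  also have "\<dots> \<le> (28.6 * of_int g)\<^sup>2 * T"
    using Kg K unfolding T_def by (intro mult_right_mono power_mono) auto
  also have "\<dots> = 817.96 * ((of_int g)\<^sup>2 * T)" by (simp add: power2_eq_square)
  \<comment> \<open>Here 817.96 * 6 < 5183: the sparse lattice has paid for the rounding.\<close>
  also have "\<dots> \<le> E" using T \<open>0 \<le> E\<close> by simp
  finally have "(of_int m)\<^sup>2 * (T * k\<^sup>2) \<le> (of_int m)\<^sup>2 * (A + 10 ^ 13 * k * P + 10 ^ 13 * k\<^sup>2)" using E by linarith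
  then have Tk: "T * k\<^sup>2 \<le> A + 10 ^ 13 * k * P + 10 ^ 13 * k\<^sup>2" using m(1) by simp
  have "path_length (map stop S) \<le> of_int g / of_int m * (l + 2 * T)"
    unfolding path_length_eq_walk_length l_def T_def
    using near[OF stop rep(2) stop rep(2)] g m by (intro walk_length_map_le) auto
  then have "(of_int m)\<^sup>2 * (path_length (map stop S) * k) \<le> (of_int m)\<^sup>2 * (of_int g / of_int m * (l + 2 * T) * k)"
    using assms(1) by (intro mult_left_mono mult_right_mono) auto
  also have "\<dots> = K * (of_int g * (l + 2 * T))" unfolding K_def using m by (simp add: field_simps power2_eq_square)
  also have "\<dots> \<le> 28.6 * of_int g * (of_int g * (l + 2 * T))"
  proof (intro mult_right_mono Kg mult_nonneg_nonneg)
    have "0 \<le> walk_length cell_dist S"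
      by (induction cell_dist S rule: walk_length.induct) (auto simp: cell_dist_def)
    then show "0 \<le> l + 2 * T" unfolding l_def T_def by simp
  qed (use g in simp)
  also have "\<dots> = 28.6 * ((of_int g)\<^sup>2 * l + 2 * ((of_int g)\<^sup>2 * T))" by (simp add: algebra_simps power2_eq_square)
  \<comment> \<open>Here 28.6 * (144 + 2 * 6) < 5183, which includes moving each stop within its
    tile.\<close>
  also have "\<dots> \<le> E" using T l \<open>0 \<le> E\<close> by simp
  finally have "(of_int m)\<^sup>2 * (path_length (map stop S) * k) \<le> (of_int m)\<^sup>2 * (A + 10 ^ 13 * k * P + 10 ^ 13 * k\<^sup>2)"
    using E by linarith
  then have "path_length (map stop S) * k \<le> A + 10 ^ 13 * k * P + 10 ^ 13 * k\<^sup>2" using m(1) by simp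
  then show thesis using that[OF cov] Tk unfolding A_def P_def T_def stop_count_def by simp
qed

theorem theorem2:
  "\<exists>c\<^sub>1 c\<^sub>2 :: real. c\<^sub>1 > 0 \<and> c\<^sub>2 > 0 \<and>
     (\<forall>\<alpha> \<beta> k :: real. \<alpha> > 0 \<longrightarrow> \<beta> > 0 \<longrightarrow> k > 0 \<longrightarrow>
       (\<forall>G. is_grid G \<longrightarrow> connected G \<longrightarrow>
         (\<exists>S. covering_path G k S \<and>
              path_cost \<alpha> \<beta> S
                \<le> 2 * sigma_param \<alpha> \<beta> k
                    * (grid_area G + c\<^sub>1 * k * perimeter G + c\<^sub>2 * k\<^sup>2))))"
\<comment> \<open>Both constants come from \<open>covering_path_exists\<close>, whose path depends
  on neither weight of the cost.\<close>
proof (rule exI[of _ "10 ^ 13"], rule exI[of _ "10 ^ 13"], intro conjI allI impI)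
  fix \<alpha> \<beta> k :: real and G
  assume pos: "0 < \<alpha>" "0 < \<beta>" "0 < k" and G: "is_grid G" "connected G"
  define Z where "Z = grid_area G + 10 ^ 13 * k * perimeter G + 10 ^ 13 * k\<^sup>2"
  obtain S where S: "covering_path G k S" "path_length S * k \<le> Z" "real (stop_count S) * k\<^sup>2 \<le> Z"
    using covering_path_exists[OF pos(3) G] unfolding Z_def .
  have "path_length S \<le> Z / k" "real (stop_count S) \<le> Z / k\<^sup>2"
    using S(2,3) pos by (simp_all add: pos_le_divide_eq)
  then have "path_cost \<alpha> \<beta> S \<le> \<alpha> * (Z / k) + \<beta> * (Z / k\<^sup>2)"
    unfolding path_cost_def using pos by (intro add_mono mult_left_mono) auto
  also have "\<dots> = (\<alpha> / k + \<beta> / k\<^sup>2) * Z" by (simp add: algebra_simps)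
  also have "\<dots> \<le> 2 * sigma_param \<alpha> \<beta> k * Z"
  proof (rule mult_right_mono[OF sigma_param_lower_bound[OF pos]])
    show "0 \<le> Z" using pos unfolding Z_def grid_area_def perimeter_def by simp
  qed
  finally show "\<exists>S. covering_path G k S \<and> path_cost \<alpha> \<beta> S
      \<le> 2 * sigma_param \<alpha> \<beta> k * (grid_area G + 10 ^ 13 * k * perimeter G + 10 ^ 13 * k\<^sup>2)"
    using S(1) unfolding Z_def by blast
qed simp_all

end
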